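(* Let $G=(V,E)$ be a connected graph with $n=|V|\ge 2$ vertices and maximum degree $\Delta$, and let $\Sigma\in M^1(G)$ (i.e. $\Sigma\in M(G)$ is $1$-faithful to $G$). Fix $0<\epsilon<1$ and let $$m=\left\lceil 18\log\left(\frac{5n^2}{\epsilon}\log(n)\right)\right\rceil .$$ Run the randomized algorithm $\mathtt{TestTree}(\Sigma,m)$. The algorithm correctly identifies whether $G$ is a tree. Moreover, with probability at least $1-\epsilon$, it runs with total query complexity $$\mathcal{O}\big(n\log(n)\,(m\min\{m,\Delta\}+\Delta)\big)=\mathcal{O}\big(n\log(n)\,(\log(n/\epsilon)\min\{\log(n/\epsilon),\Delta\}+\Delta)\big).$$
   Context: Graphs are finite, simple, undirected, with vertex set $V=[n]=\{1,\dots,n\}$. $\mathbb{S}^n_+$ is the set of real symmetric positive definite $n\times n$ matrices. $M(G)=\{\Sigma\in\mathbb{S}^n_+:(\Sigma^{-1})_{ij}=0\text{ if }i\ne j\text{ and }ij\notin E\}$. $\Sigma_{A,B}$ is the submatrix with rows $A$ and columns $B$. A set $S\subseteq V$ separates $A,A'\subseteq V$ in $G$ if every path between a vertex of $A$ and a vertex of $A'$ contains a vertex of $S$. For an integer $\tau\ge 0$, $\Sigma\in M(G)$ is $\tau$-faithful to $G$, written $\Sigma\in M^\tau(G)$, if for all $A,A',S\subseteq V$ with $|S|\le\tau$: $\operatorname{rank}(\Sigma_{A\cup S,A'\cup S})=|S|$ if and only if $S$ separates $A,A'$ in $G$. The algorithm accesses $\Sigma$ only through an oracle returning single entries of $\Sigma$;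 the query complexity is the number of entries queried. For $v\in V$, $\Sigma^{(v)}=\Sigma_{V\setminus\{v\},V\setminus\{v\}}-\frac{1}{\Sigma_{v,v}}\Sigma_{V\setminus\{v\},\{v\}}\Sigma_{\{v\},V\setminus\{v\}}$; an entry of $\Sigma^{(v)}$ is obtained from at most four entries of $\Sigma$. $\mathtt{Components}(\Sigma,W)$: set $A_0=W$, $\ell=0$. While $A_\ell\neq\emptyset$: pick a random $i\in A_\ell$, query the vector $\Sigma_{A_\ell\setminus\{i\},\{i\}}$, let $C_{\ell+1}$ consist of $i$ together with the indices of the nonzero entries of this vector, set $A_{\ell+1}=A_\ell\setminus C_{\ell+1}$ and increase $\ell$ by one. Return $C_1,\dots,C_\ell$. $\mathtt{FindBalancedPartitionTree}(\Sigma,m)$, with $V$ the index set of the rows of the current input $\Sigma$: sample a set $W\subseteq V$ of $m$ nodes uniformly at random without replacement. For each $v\in V$ run $\mathtt{Components}(\Sigma^{(v)},W\setminus\{v\})$ and let $\widehat M(v)=|V|\cdot(\text{size of the largest block returned})/|W|$. If $\min_{v\in V}\widehat M(v)>|V|/2$, break and declare that $G$ is not a tree. Otherwise return $v^*\in\arg\min_{v\in V}\widehat M(v)$ and the components returned by $\mathtt{Components}(\Sigma^{(v^* )},V\setminus\{v^*\})$. $\mathtt{TestTree}(\Sigma,m)$, with $V$ the index set of the rows of the current input: if $|V|\le m$, query the whole matrix, invert it, read off the graph given by the nonzero off-diagonal entries of the inverse and check directly whether it is a tree (if not, stop and declare that $G$ is not a tree). Otherwise run $\mathtt{FindBalancedPartitionTree}(\Sigma,m)$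 to get $v^*$ and components $C_1,\dots,C_\ell$, and for each $i=1,\dots,\ell$ run $\mathtt{TestTree}(\Sigma_{B,B},m)$ with $B=C_i\cup\{v^*\}$. If the whole recursion finishes without declaring that $G$ is not a tree, the algorithm declares that $G$ is a tree. *)

theory Defs
  imports
    "HOL-Library.Landau_Symbols"
    "HOL-Probability.Probability"
    "HOL-Probability.SPMF"
    "Jordan_Normal_Form.Gauss_Jordan_Elimination"
    "Jordan_Normal_Form.DL_Rank"
    "Jordan_Normal_Form.DL_Submatrix"
begin

section \<open>Graphs\<close>

text \<open>The vertex set is \<open>{..<n}\<close> instead of \<open>{1..n}\<close>, so that vertices are
  the row indices of an \<open>n \<times> n\<close> matrix.\<close>

definition simple_graph :: "nat set \<Rightarrow> nat set set \<Rightarrow> bool" where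
  "simple_graph V E \<longleftrightarrow> finite V \<and> E \<subseteq> {{u, v} | u v. u \<in> V \<and> v \<in> V \<and> u \<noteq> v}"

definition is_path :: "nat set \<Rightarrow> nat set set \<Rightarrow> nat list \<Rightarrow> bool" where
  "is_path V E p \<longleftrightarrow>
     p \<noteq> [] \<and> set p \<subseteq> V \<and> distinct p \<and> successively (\<lambda>u v. {u, v} \<in> E) p"

definition graph_connected :: "nat set \<Rightarrow> nat set set \<Rightarrow> bool" where
  "graph_connected V E \<longleftrightarrow>
     (\<forall>u\<in>V. \<forall>v\<in>V. \<exists>p. is_path V E p \<and> hd p = u \<and> last p = v)"

definition is_cycle :: "nat set \<Rightarrow> nat set set \<Rightarrow> nat list \<Rightarrow> bool" where
  "is_cycle V E p \<longleftrightarrow> is_path V E p \<and> length p \<ge> 3 \<and> {last p, hd p} \<in> E"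

definition is_tree :: "nat set \<Rightarrow> nat set set \<Rightarrow> bool" where
  "is_tree V E \<longleftrightarrow> V \<noteq> {} \<and> graph_connected V E \<and> (\<nexists>p. is_cycle V E p)"

definition vertex_degree :: "nat set \<Rightarrow> nat set set \<Rightarrow> nat \<Rightarrow> nat" where
  "vertex_degree V E v = card {u \<in> V. {u, v} \<in> E}"

definition max_degree :: "nat set \<Rightarrow> nat set set \<Rightarrow> nat" where
  "max_degree V E = Max (vertex_degree V E ` V)"

definition separates ::
    "nat set \<Rightarrow> nat set set \<Rightarrow> nat set \<Rightarrow> nat set \<Rightarrow> nat set \<Rightarrow> bool" where
  "separates V E S A A' \<longleftrightarrow>
     (\<forall>p. is_path V E p \<and> hd p \<in> A \<and> last p \<in> A' \<longrightarrow> set p \<inter> S \<noteq> {})"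


section \<open>Covariance matrices\<close>

definition spd_mats :: "nat \<Rightarrow> real mat set" where
  "spd_mats n = {A \<in> carrier_mat n n. transpose_mat A = A \<and>
     (\<forall>x \<in> carrier_vec n. x \<noteq> 0\<^sub>v n \<longrightarrow> 0 < scalar_prod x (A *\<^sub>v x))}"

definition graph_model :: "nat \<Rightarrow> nat set set \<Rightarrow> real mat set" where
  "graph_model n E = {\<Sigma> \<in> spd_mats n. \<forall>i<n. \<forall>j<n.
     i \<noteq> j \<and> {i, j} \<notin> E \<longrightarrow> the (mat_inverse \<Sigma>) $$ (i, j) = 0}"

abbreviation mat_rank :: "real mat \<Rightarrow> nat" where
  "mat_rank A \<equiv> vec_space.rank (dim_row A) A"

definition faithful_model :: "nat \<Rightarrow> nat \<Rightarrow> nat set set \<Rightarrow> real mat set" where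
  "faithful_model \<tau> n E = {\<Sigma> \<in> graph_model n E.
     \<forall>A A' S. A \<subseteq> {..<n} \<and> A' \<subseteq> {..<n} \<and> S \<subseteq> {..<n} \<and> card S \<le> \<tau> \<longrightarrow>
       (mat_rank (submatrix \<Sigma> (A \<union> S) (A' \<union> S)) = card S
          \<longleftrightarrow> separates {..<n} E S A A')}"


section \<open>Randomized computations with access to matrix entries\<close>

text \<open>A computation is a subprobability distribution on pairs of a result and the number of
  entries queried; missing mass is the probability of not terminating.  The only
  operation that increases the counter is \<open>query_entry\<close>, and the algorithms below see the
  matrix only through the access function they are passed.  Repeated queries of the same entry are
  counted each time.\<close>

type_synonym 'a comp = "('a \<times> nat) spmf"
type_synonym access = "nat \<Rightarrow> nat \<Rightarrow> real comp"

definition ret :: "'a \<Rightarrow> 'a comp" where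
  "ret x = return_spmf (x, 0)"

definition sample :: "'a pmf \<Rightarrow> 'a comp" where
  "sample p = map_spmf (\<lambda>x. (x, 0)) (spmf_of_pmf p)"

definition qbind :: "'a comp \<Rightarrow> ('a \<Rightarrow> 'b comp) \<Rightarrow> 'b comp"  (infixl "\<bind>\<^sub>q" 54) where
  "qbind c f = bind_spmf c (\<lambda>x. map_spmf (\<lambda>y. (fst y, snd x + snd y)) (f (fst x)))"

definition query_entry :: "real mat \<Rightarrow> access" where
  "query_entry \<Sigma> i j = return_spmf (\<Sigma> $$ (i, j), 1)"

primrec for_each :: "('a \<Rightarrow> 'b comp) \<Rightarrow> 'a list \<Rightarrow> 'b list comp" where
  "for_each f [] = ret []"
| "for_each f (x # xs) = f x \<bind>\<^sub>q (\<lambda>y. for_each f xs \<bind>\<^sub>q (\<lambda>ys. ret (y # ys)))"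

text \<open>Runs the tests in order and stops at the first one that returns \<open>False\<close>.\<close>

primrec all_tests :: "('a \<Rightarrow> bool comp) \<Rightarrow> 'a list \<Rightarrow> bool comp" where
  "all_tests f [] = ret True"
| "all_tests f (x # xs) = f x \<bind>\<^sub>q (\<lambda>b. if b then all_tests f xs else ret False)"

lemma qbind_mono [partial_function_mono]:
  assumes "mono_spmf B" and "\<And>y. mono_spmf (\<lambda>f. C y f)"
  shows "mono_spmf (\<lambda>f. B f \<bind>\<^sub>q (\<lambda>y. C y f))"
  unfolding qbind_def by (intro bind_spmf_mono map_spmf_mono assms)

lemma all_tests_mono [partial_function_mono]:
  assumes "\<And>x. mono_spmf (\<lambda>f. g x f)"
  shows "mono_spmf (\<lambda>f. all_tests (\<lambda>x. g x f) xs)"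
proof (induction xs)
  case Nil
  then show ?case by (simp add: spmf.const_mono)
next
  case (Cons x xs)
  have "mono_spmf (\<lambda>f. if b then all_tests (\<lambda>x. g x f) xs else ret False)" for b
    using Cons by (cases b) (simp_all add: spmf.const_mono)
  then show ?case by (simp add: qbind_mono assms)
qed


section \<open>The algorithms\<close>

text \<open>Entry \<open>(i, j)\<close> of \<open>\<Sigma>\<^sup>(\<^sup>v\<^sup>)\<close>, for \<open>i, j \<noteq> v\<close>.\<close>

definition schur_access :: "access \<Rightarrow> nat \<Rightarrow> access" where
  "schur_access acc v i j =
     acc i j \<bind>\<^sub>q (\<lambda>a. acc v v \<bind>\<^sub>q (\<lambda>b. acc i v \<bind>\<^sub>q (\<lambda>c. acc v j \<bind>\<^sub>q (\<lambda>d.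
     ret (a - 1 / b * (c * d))))))"

partial_function (spmf) matrix_components :: "access \<Rightarrow> nat set \<Rightarrow> nat set list comp" where
  "matrix_components acc A =
     (if A = {} then ret []
      else sample (pmf_of_set A) \<bind>\<^sub>q (\<lambda>i.
        for_each (\<lambda>j. acc j i \<bind>\<^sub>q (\<lambda>x. ret (j, x))) (sorted_list_of_set (A - {i})) \<bind>\<^sub>q (\<lambda>col.
        let C = insert i {j. \<exists>x. (j, x) \<in> set col \<and> x \<noteq> 0} in
        matrix_components acc (A - C) \<bind>\<^sub>q (\<lambda>Cs. ret (C # Cs)))))"

text \<open>The tie-breaking rule among minimizers, left unspecified by the algorithm, is a parameter:
  a possibly randomized choice of an element of the set of minimizers.\<close>

definition tie_breaking :: "(nat set \<Rightarrow> nat pmf) \<Rightarrow> bool" where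
  "tie_breaking tie \<longleftrightarrow> (\<forall>X. finite X \<and> X \<noteq> {} \<longrightarrow> set_pmf (tie X) \<subseteq> X)"

text \<open>An input matrix \<open>\<Sigma>\<^sub>V\<^sub>,\<^sub>V\<close> is given by an access function together with the index set \<open>V\<close>.
  The result \<open>None\<close> means that the algorithm declares that the graph is not a tree.\<close>

definition find_balanced_partition_tree ::
    "(nat set \<Rightarrow> nat pmf) \<Rightarrow> access \<Rightarrow> nat set \<Rightarrow> nat \<Rightarrow> (nat \<times> nat set list) option comp" where
  "find_balanced_partition_tree tie acc V m =
     sample (pmf_of_set {W. W \<subseteq> V \<and> card W = m}) \<bind>\<^sub>q (\<lambda>W.
     for_each (\<lambda>v. matrix_components (schur_access acc v) (W - {v}) \<bind>\<^sub>q (\<lambda>Cs.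
         ret (v, real (card V) * real (Max (insert 0 (card ` set Cs))) / real (card W))))
       (sorted_list_of_set V) \<bind>\<^sub>q (\<lambda>Ms.
     let M = (\<lambda>v. the (map_of Ms v)) in
     if Min (M ` V) > real (card V) / 2 then ret None
     else sample (tie {v. is_arg_min M (\<lambda>v. v \<in> V) v}) \<bind>\<^sub>q (\<lambda>v.
       matrix_components (schur_access acc v) (V - {v}) \<bind>\<^sub>q (\<lambda>Cs. ret (Some (v, Cs))))))"

text \<open>The rows of the queried matrix are listed in increasing order of \<open>V\<close>, so the graph of
  its inverse lives on the positions \<open>{..<card V}\<close>.\<close>

definition support_edges :: "real mat \<Rightarrow> nat set set" where
  "support_edges K = {{i, j} | i j. i < dim_row K \<and> j < dim_col K \<and> i \<noteq> j \<and> K $$ (i, j) \<noteq> 0}"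

partial_function (spmf) test_tree ::
    "(nat set \<Rightarrow> nat pmf) \<Rightarrow> access \<Rightarrow> nat set \<Rightarrow> nat \<Rightarrow> bool comp" where
  "test_tree tie acc V m =
     (if card V \<le> m then
        for_each (\<lambda>i. for_each (\<lambda>j. acc i j) (sorted_list_of_set V)) (sorted_list_of_set V) \<bind>\<^sub>q
        (\<lambda>rows. ret (is_tree {..<card V}
           (support_edges (the (mat_inverse (mat_of_rows_list (card V) rows))))))
      else
        find_balanced_partition_tree tie acc V m \<bind>\<^sub>q (\<lambda>r.
        case r of
          None \<Rightarrow> ret False
        | Some vCs \<Rightarrow>
            all_tests (\<lambda>C. test_tree tie acc (insert (fst vCs) C) m) (snd vCs)))"


section \<open>Parameters\<close>

definition sample_size :: "nat \<Rightarrow> real \<Rightarrow> nat" where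
  "sample_size n \<epsilon> = nat \<lceil>18 * ln (5 * (real n)\<^sup>2 / \<epsilon> * ln (real n))\<rceil>"

definition admissible :: "(nat \<times> nat \<times> real) set" where
  "admissible = {(n, \<Delta>, \<epsilon>). 2 \<le> n \<and> 1 \<le> \<Delta> \<and> \<Delta> < n \<and> 0 < \<epsilon> \<and> \<epsilon> < 1}"

text \<open>Landau symbol in the three parameters \<open>n\<close>, \<open>\<Delta>\<close>, \<open>\<epsilon>\<close>; over a principal filter it means
  that one constant works for all admissible values.\<close>

abbreviation bigO :: "(nat \<times> nat \<times> real \<Rightarrow> real) \<Rightarrow> (nat \<times> nat \<times> real \<Rightarrow> real) set" where
  "bigO \<equiv> bigo (principal admissible)"

definition bound_m :: "nat \<times> nat \<times> real \<Rightarrow> real" where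
  "bound_m = (\<lambda>(n, \<Delta>, \<epsilon>).
     let m = real (sample_size n \<epsilon>)
     in real n * ln (real n) * (m * min m (real \<Delta>) + real \<Delta>))"

definition bound_log :: "nat \<times> nat \<times> real \<Rightarrow> real" where
  "bound_log = (\<lambda>(n, \<Delta>, \<epsilon>).
     let L = ln (real n / \<epsilon>)
     in real n * ln (real n) * (L * min L (real \<Delta>) + real \<Delta>))"

end

theory Submission
  imports Defs "Jordan_Normal_Form.DL_Rank_Submatrix"
begin

text \<open>
  By 1-faithfulness \<open>\<Sigma>\<^sub>i\<^sub>j \<Sigma>\<^sub>v\<^sub>v = \<Sigma>\<^sub>i\<^sub>v \<Sigma>\<^sub>v\<^sub>j\<close> holds iff \<open>v\<close> separates \<open>i\<close> from \<open>j\<close>, so the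
  Schur complements reveal the components of \<open>G - v\<close>, and this passes to each block \<open>C \<union> {v}\<close>,
  with \<open>C\<close> such a component; \<open>G\<close> is a tree iff all these blocks are. A tree has a centroid with
  respect to every sample \<open>W\<close>, so a failing search for a balanced vertex proves that \<open>G\<close> is
  not a tree. In the base case the inverse of the marginal covariance is supported on edges of
  the block, and its support is a tree iff the block is one.

  For the query bound, a component with more than \<open>15/16\<close> of the vertices contains at most half of
  the sample with probability at most \<open>2\<^sup>-\<^sup>m\<close>. Write \<open>s\<close> for the number of vertices of a block minus
  one: it is additive over the children of a recursive call, so each level costs \<open>O(n (m min(m, \<Delta>) + \<Delta>))\<close>,
  and outside the bad event it shrinks by a factor \<open>31/32\<close>, so there are \<open>O(log n)\<close> levels. Every call
  that recurses has at least two children, so there are at most \<open>n\<close> of them, and the union bound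
  gives a failure probability of at most \<open>n\<^sup>3 / 2\<^sup>m \<le> \<epsilon>\<close>.\<close>

section \<open>Quantitative reasoning about computations\<close>

text \<open>Correctness holds on every run; randomness affects only the number of queries. Two
  judgements are carried along accordingly: one for all outcomes, termination included, and one
  bounding the probability of exceeding a query budget. Even the shrinking behind termination holds
  on every run: an accepted vertex splits the sample, so it leaves at least two components, balanced
  or not.

  The obstacle is the base case. The model forces zeros of the inverse off \<open>E\<close> but
  permits zeros on edges, so the graph read off may be a proper subgraph of the block. The recursion
  therefore carries positive definiteness and an inverse vanishing off \<open>E\<close>, besides the
  separation criterion.

  The ratio 16 comes from counting: half of the sample falling into a sixteenth of the vertices
  contributes 16^(-m/2) = 4^(-m), the choice of that half at most 2^m, and 2^(-m) remains.\<close>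

definition surely :: "'a comp \<Rightarrow> ('a \<Rightarrow> nat \<Rightarrow> bool) \<Rightarrow> bool" where
  "surely c P \<longleftrightarrow> lossless_spmf c \<and> (\<forall>z\<in>set_spmf c. P (fst z) (snd z))"

text \<open>Mass lost to nontermination is not counted: a diverging computation has failure 0.
  Bounds on \<open>failure\<close> are therefore paired with the losslessness contained in
  \<open>surely\<close>.\<close>

definition failure :: "'a comp \<Rightarrow> ('a \<Rightarrow> nat \<Rightarrow> bool) \<Rightarrow> real" where
  "failure c P = measure (measure_spmf c) {z. \<not> P (fst z) (snd z)}"

lemma surely_mono:
  assumes "surely c P" "\<And>x q. P x q \<Longrightarrow> Q x q"
  shows "surely c Q"
  using assms by (auto simp: surely_def)

lemma surely_ret [simp]: "surely (ret x) P \<longleftrightarrow> P x 0"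
  by (simp add: surely_def ret_def)

lemma surely_sample [simp]: "surely (sample p) P \<longleftrightarrow> (\<forall>x\<in>set_pmf p. P x 0)"
  by (auto simp: surely_def sample_def)

lemma surely_query_entry: "surely (query_entry \<Sigma> i j) (\<lambda>x q. x = \<Sigma> $$ (i, j) \<and> q = 1)"
  by (simp add: surely_def query_entry_def)

lemma surely_qbind:
  assumes "surely c P" "\<And>x q. P x q \<Longrightarrow> surely (f x) (\<lambda>y r. R y (q + r))"
  shows "surely (c \<bind>\<^sub>q f) R"
  using assms unfolding surely_def qbind_def
  by (fastforce simp: set_bind_spmf)

lemma surely_for_each:
  assumes "\<And>x. x \<in> set xs \<Longrightarrow> surely (f x) (\<lambda>y q. P x y \<and> q \<le> b)"
  shows "surely (for_each f xs) (\<lambda>ys q. list_all2 P xs ys \<and> q \<le> b * length xs)"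
  using assms
proof (induction xs)
  case (Cons x xs)
  show ?case unfolding for_each.simps
    apply (rule surely_qbind[OF Cons.prems[of x]], simp)
    apply (rule surely_qbind[OF Cons.IH], rule Cons.prems, simp)
    apply simp
    done
qed simp

lemma failure_le_1: "failure c P \<le> 1"
  by (simp add: failure_def measure_spmf.subprob_measure_le_1)

lemma failure_nonneg: "failure c P \<ge> 0"
  by (simp add: failure_def)

text \<open>Results outside the support carry no mass, so the implication has to hold only under a
  sure invariant.\<close>

lemma failure_mono:
  assumes "surely c S" "\<And>x q. S x q \<Longrightarrow> P x q \<Longrightarrow> Q x q"
  shows "failure c Q \<le> failure c P"
proof -
  have "failure c Q = measure (measure_spmf c) ({z. \<not> Q (fst z) (snd z)} \<inter> set_spmf c)"
    unfolding failure_def by (rule measure_spmf.finite_measure_eq_AE) auto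
  also have "\<dots> \<le> failure c P"
    unfolding failure_def using assms
    by (intro measure_spmf.finite_measure_mono) (auto simp: surely_def)
  finally show ?thesis .
qed

lemma failure_eq_0: "surely c P \<Longrightarrow> failure c P = 0"
  using failure_mono[of c P "\<lambda>_ _. True" P] failure_nonneg[of c P] by (simp add: failure_def order_antisym)

lemma failure_sample: "failure (sample p) P = measure (measure_pmf p) {x. \<not> P x 0}"
  by (simp add: failure_def sample_def measure_map_spmf measure_spmf_spmf_of_pmf vimage_def)

text \<open>Union bound over two stages: a bad intermediate result is charged to \<open>d\<close>, a
  bad continuation after a good one to \<open>e\<close>. The sure postcondition \<open>P\<close>
  comes in addition to \<open>G\<close> and costs no probability.\<close>

lemma failure_qbind:
  assumes "surely c P" "failure c G \<le> d" "0 \<le> e"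
    and "\<And>x q. P x q \<Longrightarrow> G x q \<Longrightarrow> failure (f x) (\<lambda>y r. R y (q + r)) \<le> e"
  shows "failure (c \<bind>\<^sub>q f) R \<le> d + e"
proof -
  let ?f = "\<lambda>x. map_spmf (\<lambda>y. (fst y, snd x + snd y)) (f (fst x))"
  let ?B = "{z. \<not> R (fst z) (snd z)}" and ?A = "{z. \<not> G (fst z) (snd z)}"
  have eq: "emeasure (measure_spmf (?f x)) ?B = ennreal (failure (f (fst x)) (\<lambda>y r. R y (snd x + r)))" for x
    by (simp add: failure_def measure_spmf.emeasure_eq_measure measure_map_spmf vimage_def)
  have "emeasure (measure_spmf (c \<bind>\<^sub>q f)) ?B = (\<integral>\<^sup>+ x. emeasure (measure_spmf (?f x)) ?B \<partial>measure_spmf c)"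
    unfolding qbind_def measure_spmf_bind
    by (subst emeasure_bind[where N = "count_space UNIV"])
      (simp_all add: space_subprob_algebra space_measure_spmf)
  \<comment> \<open>The continuation fails with probability at most 1 after a bad intermediate
    result and at most \<open>e\<close> otherwise.\<close>
  also have "\<dots> \<le> (\<integral>\<^sup>+ x. indicator ?A x + ennreal e \<partial>measure_spmf c)"
  proof (rule nn_integral_mono_AE, rule AE_measure_spmf_iff[THEN iffD2], intro ballI)
    fix x assume x: "x \<in> set_spmf c"
    show "emeasure (measure_spmf (?f x)) ?B \<le> indicator ?A x + ennreal e"
    proof (cases "x \<in> ?A")
      case True
      then show ?thesis unfolding eq
        using failure_le_1[of "f (fst x)" "\<lambda>y r. R y (snd x + r)"]
        by (simp add: add_increasing2 ennreal_le_1)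
    next
      case False
      then show ?thesis unfolding eq
        using assms(1) assms(4)[of "fst x" "snd x"] x by (auto simp: surely_def intro!: ennreal_leI)
    qed
  qed
  also have "\<dots> = emeasure (measure_spmf c) ?A + ennreal e * emeasure (measure_spmf c) UNIV"
    by (subst nn_integral_add) (auto simp: space_measure_spmf)
  also have "\<dots> \<le> ennreal d + ennreal e * 1"
    using assms(2) measure_spmf.subprob_emeasure_le_1[of c UNIV]
    by (intro add_mono mult_left_mono)
      (auto simp: failure_def measure_spmf.emeasure_eq_measure intro!: ennreal_leI)
  also have "\<dots> = ennreal (d + e)"
    using assms(3) order_trans[OF failure_nonneg assms(2)] by (simp add: ennreal_plus)
  finally show ?thesis
    using assms(3) order_trans[OF failure_nonneg assms(2)]
    by (simp add: failure_def measure_spmf.emeasure_eq_measure del: ennreal_plus)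
qed

lemma surely_all_tests:
  assumes "\<And>x. x \<in> set xs \<Longrightarrow> surely (f x) (\<lambda>b q. b = P x)"
  shows "surely (all_tests f xs) (\<lambda>b q. b = (\<forall>x\<in>set xs. P x))"
  using assms
proof (induction xs)
  case (Cons x xs)
  show ?case unfolding all_tests.simps
    apply (rule surely_qbind[OF Cons.prems[of x]], simp)
    using Cons.IH Cons.prems by auto
qed simp

text \<open>Stopping early only saves queries, so the nonnegative budgets of skipped tests may stay
  in the sum.\<close>

lemma failure_all_tests:
  fixes B D :: "'a \<Rightarrow> real"
  assumes "\<And>x. x \<in> set xs \<Longrightarrow> surely (f x) (\<lambda>b q. b = P x)"
    and "\<And>x. x \<in> set xs \<Longrightarrow> failure (f x) (\<lambda>b q. real q \<le> B x) \<le> D x"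
    and "\<And>x. x \<in> set xs \<Longrightarrow> 0 \<le> B x" and "\<And>x. x \<in> set xs \<Longrightarrow> 0 \<le> D x"
  shows "failure (all_tests f xs) (\<lambda>b q. real q \<le> sum_list (map B xs)) \<le> sum_list (map D xs)"
  using assms
proof (induction xs)
  case Nil
  show ?case by (simp add: failure_eq_0)
next
  case (Cons x xs)
  have B: "0 \<le> sum_list (map B xs)" and D: "0 \<le> sum_list (map D xs)"
    using Cons.prems by (auto intro!: sum_list_nonneg)
  have IH: "failure (all_tests f xs) (\<lambda>b q. real q \<le> sum_list (map B xs)) \<le> sum_list (map D xs)"
    using Cons by auto
  have s: "surely (all_tests f xs) (\<lambda>b q. b = (\<forall>x\<in>set xs. P x))"
    using Cons.prems(1) by (intro surely_all_tests) simp
  show ?case unfolding all_tests.simps list.map sum_list.Cons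
  proof (rule failure_qbind[OF Cons.prems(1) Cons.prems(2)])
    fix b q assume q: "real q \<le> B x"
    show "failure (if b then all_tests f xs else ret False) (\<lambda>y r. real (q + r) \<le> B x + sum_list (map B xs))
       \<le> sum_list (map D xs)"
    proof (cases b)
      case True
      have "failure (all_tests f xs) (\<lambda>y r. real (q + r) \<le> B x + sum_list (map B xs)) \<le> 
            failure (all_tests f xs) (\<lambda>y r. real r \<le> sum_list (map B xs))"
        using q by (intro failure_mono[OF s]) auto
      with IH True show ?thesis by simp
    next
      case False
      then show ?thesis using q B D by (simp add: failure_eq_0)
    qed
  qed (use D in auto)
qed

section \<open>Connectivity and trees\<close>

text \<open>With both ends in \<open>A\<close>, the closure is connectivity in the induced subgraph,
  and deleting a vertex shrinks \<open>A\<close> while \<open>E\<close> stays fixed. A vertex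
  outside \<open>A\<close> reaches exactly itself.\<close>

definition adj :: "nat set \<Rightarrow> nat set set \<Rightarrow> nat \<Rightarrow> nat \<Rightarrow> bool" where
  "adj A E x y \<longleftrightarrow> x \<in> A \<and> y \<in> A \<and> {x, y} \<in> E"

abbreviation reach :: "nat set \<Rightarrow> nat set set \<Rightarrow> nat \<Rightarrow> nat \<Rightarrow> bool" where
  "reach A E \<equiv> (adj A E)\<^sup>*\<^sup>*"

lemma reach_sym: "reach A E x y \<Longrightarrow> reach A E y x"
  by (rule sympD[OF symp_rtranclp]) (auto simp: symp_def adj_def insert_commute)

lemma equivp_reach: "equivp (reach A E)"
  by (rule equivpI) (auto simp: reflp_def symp_def transp_def intro: reach_sym)

lemma reach_in: "reach A E x y \<Longrightarrow> x \<in> A \<Longrightarrow> y \<in> A"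
  by (induction rule: rtranclp_induct) (auto simp: adj_def)

lemma reach_mono: "reach A E x y \<Longrightarrow> A \<subseteq> B \<Longrightarrow> reach B E x y"
  by (erule rtranclp_mono[THEN predicate2D, rotated]) (auto simp: adj_def)

text \<open>Edges may be contracted, so this serves isomorphisms as well as retractions. Walks
  survive such maps, whereas images of paths may repeat vertices.\<close>

lemma reach_map:
  assumes "reach A E x y" "\<And>a b. adj A E a b \<Longrightarrow> adj B F (f a) (f b) \<or> f a = f b"
  shows "reach B F (f x) (f y)"
  using assms(1)
  by induction (auto dest!: assms(2) intro: rtranclp.rtrancl_into_rtrancl)

lemma path_reach: "is_path A E p \<Longrightarrow> reach A E (hd p) (last p)"
proof (induction p)
  case (Cons x p)
  show ?case
  proof (cases p)
    case (Cons y q)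
    with Cons.prems have "is_path A E p" "adj A E x y"
      by (auto simp: is_path_def adj_def)
    with Cons.IH Cons show ?thesis by (auto intro: converse_rtranclp_into_rtranclp)
  qed simp
qed (simp add: is_path_def)

lemma reach_path:
  assumes "reach A E x y" "y \<in> A"
  shows "\<exists>p. is_path A E p \<and> hd p = x \<and> last p = y"
  using assms
proof (induction rule: converse_rtranclp_induct)
  case base
  then show ?case by (intro exI[of _ "[y]"]) (simp add: is_path_def)
next
  case (step x z)
  then obtain p where p: "is_path A E p" "hd p = z" "last p = y" by blast
  show ?case
  proof (cases "x \<in> set p")
    case True
    \<comment> \<open>A second visit to \<open>x\<close>: dropping the part of the path before it
      keeps the vertices distinct.\<close>
    then obtain q r where "p = q @ x # r" by (auto simp: in_set_conv_decomp)
    with p show ?thesis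
      by (intro exI[of _ "x # r"]) (auto simp: is_path_def successively_append_iff)
  next
    case False
    with p step.hyps(1) show ?thesis
      by (intro exI[of _ "x # p"]) (cases p; auto simp: is_path_def adj_def)
  qed
qed

lemma reach_iff_path:
  assumes "x \<in> A"
  shows "reach A E x y \<longleftrightarrow> (\<exists>p. is_path A E p \<and> hd p = x \<and> last p = y)"
  using reach_path reach_in[OF _ assms] path_reach by blast

lemma graph_connected_iff: "graph_connected V E \<longleftrightarrow> (\<forall>u\<in>V. \<forall>v\<in>V. reach V E u v)"
  by (simp add: graph_connected_def reach_iff_path)

lemma separates_vertex_iff:
  assumes "i \<in> V" "i \<noteq> v"
  shows "separates V E {v} {i} {j} \<longleftrightarrow> \<not> reach (V - {v}) E i j"
proof -
  have "is_path (V - {v}) E p \<longleftrightarrow> is_path V E p \<and> set p \<inter> {v} = {}" for p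
    by (auto simp: is_path_def)
  then show ?thesis
    using assms reach_iff_path[of i "V - {v}" E j] by (auto simp: separates_def)
qed

text \<open>Two neighbours of \<open>v\<close> joined in \<open>B - {v}\<close> close a cycle
  through \<open>v\<close>. This form of acyclicity speaks only of connectivity after deleting a
  vertex, which is what faithfulness controls.\<close>

definition acyc :: "nat set \<Rightarrow> nat set set \<Rightarrow> bool" where
  "acyc B E \<longleftrightarrow> (\<forall>v\<in>B. \<forall>x\<in>B - {v}. \<forall>y\<in>B - {v}.
     {v, x} \<in> E \<and> {v, y} \<in> E \<and> x \<noteq> y \<longrightarrow> \<not> reach (B - {v}) E x y)"

lemma acycD:
  assumes "acyc B E" "v \<in> B" "x \<in> B" "y \<in> B" "v \<noteq> x" "v \<noteq> y" "{v, x} \<in> E" "{v, y} \<in> E"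
    "reach (B - {v}) E x y"
  shows "x = y"
  using assms by (auto simp: acyc_def)

lemma acyc_iff: "acyc B E \<longleftrightarrow> (\<nexists>p. is_cycle B E p)"
proof
  assume a: "acyc B E"
  show "\<nexists>p. is_cycle B E p"
  proof
    assume "\<exists>p. is_cycle B E p"
    then obtain p where p: "is_cycle B E p" by blast
    then obtain v x q where pq: "p = v # x # q" "q \<noteq> []"
      by (cases p; cases "tl p"; cases "tl (tl p)") (auto simp: is_cycle_def)
    with p have "is_path (B - {v}) E (x # q)" and *: "v \<in> B" "x \<in> B" "v \<noteq> x" "{v, x} \<in> E"
      "{last q, v} \<in> E" "set q \<subseteq> B" "distinct (v # x # q)"
      by (auto simp: is_cycle_def is_path_def)
    from path_reach[OF this(1)] pq have "reach (B - {v}) E x (last q)" by simp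
    moreover have "last q \<in> set q" using pq by simp
    ultimately have "x = last q"
      using * a by (intro acycD[of B E v]) (auto simp: insert_commute)
    with * \<open>last q \<in> set q\<close> show False by auto
  qed
next
  assume n: "\<nexists>p. is_cycle B E p"
  show "acyc B E"
    unfolding acyc_def
  proof (intro ballI impI notI)
    fix v x y assume v: "v \<in> B" "x \<in> B - {v}" "y \<in> B - {v}" "{v, x} \<in> E \<and> {v, y} \<in> E \<and> x \<noteq> y"
      "reach (B - {v}) E x y"
    from reach_path[OF v(5) v(3)] obtain p where p: "is_path (B - {v}) E p" "hd p = x" "last p = y"
      by blast
    then have "is_cycle B E (v # p)"
      using v by (cases p; cases "tl p") (auto simp: is_cycle_def is_path_def insert_commute)
    with n show False by blast
  qed
qed

lemma is_tree_iff: "is_tree B E \<longleftrightarrow> B \<noteq> {} \<and> (\<forall>u\<in>B. \<forall>v\<in>B. reach B E u v) \<and> acyc B E"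
  by (simp add: is_tree_def acyc_iff graph_connected_iff)

text \<open>One implication suffices, since the inverse bijection has the same property. Edges are
  compared only inside \<open>A\<close>, as \<open>E\<close> and \<open>F\<close> may contain
  others.\<close>

lemma is_tree_image:
  assumes f: "bij_betw f A B" and e: "\<And>x y. x \<in> A \<Longrightarrow> y \<in> A \<Longrightarrow> {f x, f y} \<in> F \<longleftrightarrow> {x, y} \<in> E"
    and t: "is_tree A E"
  shows "is_tree B F"
proof -
  define g where "g = inv_into A f"
  have g: "g y \<in> A" "f (g y) = y" if "y \<in> B" for y
    using that f by (auto simp: g_def bij_betw_def inv_into_into f_inv_into_f)
  have B: "B = f ` A" using f by (simp add: bij_betw_def)
  have "reach B F x y" if "x \<in> B" "y \<in> B" for x y
  proof -
    have "reach A E (g x) (g y)" using t g that by (auto simp: is_tree_iff)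
    then have "reach B F (f (g x)) (f (g y))"
      by (rule reach_map) (auto simp: adj_def e B)
    with g that show ?thesis by simp
  qed
  moreover have "acyc B F"
    unfolding acyc_def
  proof (intro ballI impI notI)
    fix v x y assume v: "v \<in> B" "x \<in> B - {v}" "y \<in> B - {v}" "{v, x} \<in> F \<and> {v, y} \<in> F \<and> x \<noteq> y"
      "reach (B - {v}) F x y"
    have ge: "{g a, g b} \<in> E \<longleftrightarrow> {a, b} \<in> F" if "a \<in> B" "b \<in> B" for a b
      using e[of "g a" "g b"] g that by auto
    have ginj: "g a = g b \<longleftrightarrow> a = b" if "a \<in> B" "b \<in> B" for a b
      using g that by metis
    have "reach (A - {g v}) E (g x) (g y)"
      using v(5) by (rule reach_map) (auto simp: adj_def ge g ginj v)
    then have "g x = g y"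
      using t v ge g ginj by (intro acycD[of A E "g v"]) (auto simp: is_tree_iff)
    with v ginj show False by auto
  qed
  ultimately show ?thesis using t by (auto simp: is_tree_iff B)
qed

lemma is_tree_cong:
  assumes "\<And>x y. x \<in> A \<Longrightarrow> y \<in> A \<Longrightarrow> {x, y} \<in> E \<longleftrightarrow> {x, y} \<in> F"
  shows "is_tree A E \<longleftrightarrow> is_tree A F"
  using is_tree_image[of id A A E F] is_tree_image[of id A A F E] assms by auto

section \<open>Classes of an equivalence relation on a vertex set\<close>

text \<open>Relation and ground set are separate parameters: \<open>R\<close> will be connectivity
  in a block without \<open>v\<close>, while \<open>A\<close> may be only a sample. Two sampled
  vertices then share a class even if every walk between them leaves the sample.\<close>

definition blocks :: "(nat \<Rightarrow> nat \<Rightarrow> bool) \<Rightarrow> nat set \<Rightarrow> nat set set" where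
  "blocks R A = (\<lambda>x. {y \<in> A. R x y}) ` A"

lemma finite_blocks [simp]: "finite A \<Longrightarrow> finite (blocks R A)"
  by (simp add: blocks_def)

lemma blocks_subset: "C \<in> blocks R A \<Longrightarrow> C \<subseteq> A"
  by (auto simp: blocks_def)

lemma block_nonempty: "equivp R \<Longrightarrow> C \<in> blocks R A \<Longrightarrow> C \<noteq> {}"
  by (auto simp: blocks_def dest: equivp_reflp)

lemma block_eq: "equivp R \<Longrightarrow> C \<in> blocks R A \<Longrightarrow> x \<in> C \<Longrightarrow> C = {y \<in> A. R x y}"
  by (auto simp: blocks_def dest: equivp_symp equivp_transp)

lemma Union_blocks: "equivp R \<Longrightarrow> \<Union> (blocks R A) = A"
  by (auto simp: blocks_def dest: equivp_reflp)

lemma disjoint_blocks: "equivp R \<Longrightarrow> disjoint (blocks R A)"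
  using block_eq[of R _ A] by (intro disjointI) blast

lemma sum_card_blocks:
  assumes "equivp R" "finite A"
  shows "(\<Sum>C\<in>blocks R A. card C) = card A"
  using card_Union_disjoint[OF disjoint_blocks[OF assms(1)], of A] assms
  by (metis Union_blocks blocks_subset finite_subset)

text \<open>One round of the component search: removing the class of the pivot leaves the other
  classes intact.\<close>

lemma blocks_remove:
  assumes R: "equivp R" and i: "i \<in> A" and C: "C = {y \<in> A. R i y}"
  shows "blocks R A = insert C (blocks R (A - C))" "C \<notin> blocks R (A - C)"
proof -
  have eq: "{y \<in> A. R x y} = {y \<in> A - C. R x y}" if "x \<in> A - C" for x
    using that R by (auto simp: C dest: equivp_symp equivp_transp)
  have eq2: "{y \<in> A. R x y} = C" if "x \<in> C" for x
    using that block_eq[OF R, of C A x] i by (auto simp: C blocks_def)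
  have iC: "i \<in> C" using R i by (auto simp: C dest: equivp_reflp)
  have "A = C \<union> (A - C)" by (auto simp: C)
  then have "blocks R A = (\<lambda>x. {y \<in> A. R x y}) ` C \<union> (\<lambda>x. {y \<in> A. R x y}) ` (A - C)"
    unfolding blocks_def by (metis image_Un)
  also have "(\<lambda>x. {y \<in> A. R x y}) ` C = {C}"
    using eq2 iC by auto
  also have "(\<lambda>x. {y \<in> A. R x y}) ` (A - C) = blocks R (A - C)"
    unfolding blocks_def using eq by (intro image_cong) auto
  finally show "blocks R A = insert C (blocks R (A - C))" by simp
  show "C \<notin> blocks R (A - C)" using blocks_subset[of C R "A - C"] iC by auto
qed

lemma card_blocks_le:
  assumes "equivp R" "finite A"
  shows "card (blocks R A) \<le> card A"
  unfolding blocks_def by (rule card_image_le) fact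

text \<open>Every class of \<open>W\<close> is the trace on \<open>W\<close> of a class of
  \<open>A\<close>.\<close>

lemma card_blocks_mono:
  assumes "equivp R" "finite A" "W \<subseteq> A"
  shows "card (blocks R W) \<le> card (blocks R A)"
proof -
  have "blocks R W \<subseteq> (\<lambda>C. C \<inter> W) ` blocks R A"
  proof
    fix C assume "C \<in> blocks R W"
    then obtain x where "x \<in> W" "C = {y \<in> W. R x y}" by (auto simp: blocks_def)
    with assms(3) have "C = {y \<in> A. R x y} \<inter> W" "{y \<in> A. R x y} \<in> blocks R A"
      by (auto simp: blocks_def)
    then show "C \<in> (\<lambda>C. C \<inter> W) ` blocks R A" by blast
  qed
  from card_mono[OF _ this] show ?thesis
    using assms card_image_le[of "blocks R A" "\<lambda>C. C \<inter> W"] by fastforce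
qed

text \<open>Take the vertex just before the first visit of the walk to \<open>v\<close>.\<close>

lemma reach_neighbour:
  assumes "reach B E x v" "x \<noteq> v"
  shows "\<exists>u\<in>B - {v}. {u, v} \<in> E \<and> reach (B - {v}) E x u"
  using assms
proof (induction rule: converse_rtranclp_induct)
  case (step x y)
  show ?case
  proof (cases "y = v")
    case True
    with step show ?thesis by (intro bexI[of _ x]) (auto simp: adj_def)
  next
    case False
    with step obtain u where u: "u \<in> B - {v}" "{u, v} \<in> E" "reach (B - {v}) E y u" by blast
    moreover have "adj (B - {v}) E x y" using step False by (auto simp: adj_def)
    ultimately show ?thesis by (auto intro: converse_rtranclp_into_rtranclp)
  qed
qed simp

text \<open>Each component contains a neighbour of \<open>v\<close>, so the neighbours map onto the
  components. This is how the degree enters the query count.\<close>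

lemma card_components_le_degree:
  assumes "finite B" "v \<in> B" "\<And>x. x \<in> B \<Longrightarrow> reach B E x v"
  shows "card (blocks (reach (B - {v}) E) (B - {v})) \<le> card {u \<in> B. {u, v} \<in> E}"
proof -
  have "blocks (reach (B - {v}) E) (B - {v})
      \<subseteq> (\<lambda>u. {y \<in> B - {v}. reach (B - {v}) E u y}) ` {u \<in> B. {u, v} \<in> E}"
  proof
    fix C assume "C \<in> blocks (reach (B - {v}) E) (B - {v})"
    then obtain x where x: "x \<in> B" "x \<noteq> v" and C: "C = {y \<in> B - {v}. reach (B - {v}) E x y}"
      by (auto simp: blocks_def)
    from reach_neighbour[OF assms(3)[OF x(1)] x(2)] obtain u
      where u: "u \<in> B - {v}" "{u, v} \<in> E" "reach (B - {v}) E x u" by blast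
    have "C = {y \<in> B - {v}. reach (B - {v}) E u y}"
      unfolding C using u(3) by (auto intro: reach_sym rtranclp_trans)
    with u show "C \<in> (\<lambda>u. {y \<in> B - {v}. reach (B - {v}) E u y}) ` {u \<in> B. {u, v} \<in> E}"
      by blast
  qed
  then show ?thesis using assms(1) by (intro surj_card_le) auto
qed

section \<open>Splitting a graph at a vertex\<close>

text \<open>Collapsing everything outside a component \<open>C\<close> of \<open>B - {v}\<close> to \<open>v\<close> maps walks to walks.\<close>

lemma adj_retract:
  assumes C: "C \<in> blocks (reach (B - {v}) E) (B - {v})" and "v \<in> B" "adj B E x y"
  defines "f \<equiv> \<lambda>x. if x \<in> C then x else v"
  shows "adj (insert v C) E (f x) (f y) \<or> f x = f y"
proof -
  have *: "y \<in> C \<or> y = v" if "x \<in> C" "adj B E x y" for x y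
  proof (rule ccontr)
    assume n: "\<not> (y \<in> C \<or> y = v)"
    have "adj (B - {v}) E x y"
      using that n blocks_subset[OF C] by (auto simp: adj_def)
    then have "y \<in> C"
      using block_eq[OF equivp_reach C that(1)] by (auto simp: adj_def)
    with n show False by simp
  qed
  have "adj B E y x" using assms(3) by (auto simp: adj_def insert_commute)
  with *[of x y] *[of y x] assms(3) show ?thesis
    by (auto simp: f_def adj_def)
qed

text \<open>The collapse fixes \<open>insert v C\<close> pointwise, so the image of the walk keeps
  its ends.\<close>

lemma reach_split_all:
  assumes C: "C \<in> blocks (reach (B - {v}) E) (B - {v})" and "v \<in> B"
    and "i \<in> insert v C" "j \<in> insert v C" "reach B E i j"
  shows "reach (insert v C) E i j"
  using reach_map[of B E i j "insert v C" E "\<lambda>x. if x \<in> C then x else v", OF assms(5)]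
    adj_retract[OF C assms(2)] assms(3,4) by (auto split: if_splits)

text \<open>For \<open>w = v\<close> the walk cannot leave \<open>C\<close>. For \<open>w\<close> in
  \<open>C\<close> the collapse sends vertices outside \<open>C\<close> to \<open>v\<close>, never
  to \<open>w\<close>, so the image still avoids \<open>w\<close>. The separation criterion thus
  passes to blocks unchanged.\<close>

lemma reach_split:
  assumes C: "C \<in> blocks (reach (B - {v}) E) (B - {v})" and v: "v \<in> B"
    and w: "w \<in> insert v C" and ij: "i \<in> insert v C - {w}" "j \<in> insert v C - {w}"
  shows "reach (B - {w}) E i j \<longleftrightarrow> reach (insert v C - {w}) E i j"
proof
  have sub: "C \<subseteq> B - {v}" by (rule blocks_subset[OF C])
  show "reach (insert v C - {w}) E i j \<Longrightarrow> reach (B - {w}) E i j"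
    using sub v by (erule_tac reach_mono) auto
  assume r: "reach (B - {w}) E i j"
  show "reach (insert v C - {w}) E i j"
  proof (cases "w = v")
    case True
    with ij sub have vC: "v \<notin> C" "i \<in> C" by auto
    have "reach (insert v C - {w}) E i j \<and> j \<in> C"
      using r
    proof (induction rule: rtranclp_induct)
      case (step y z)
      then have "z \<in> C"
        using block_eq[OF equivp_reach C, of y] True by (auto simp: adj_def)
      with step vC True have "adj (insert v C - {w}) E y z" by (auto simp: adj_def)
      with step \<open>z \<in> C\<close> show ?case by (auto intro: rtranclp.rtrancl_into_rtrancl)
    qed (use vC in auto)
    then show ?thesis ..
  next
    case False
    let ?f = "\<lambda>x. if x \<in> C then x else v"
    have "reach (insert v C - {w}) E (?f i) (?f j)"
      using r
    proof (rule reach_map)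
      fix a b assume ab: "adj (B - {w}) E a b"
      then have "adj B E a b" by (auto simp: adj_def)
      from adj_retract[OF C v this] ab False
      show "adj (insert v C - {w}) E (?f a) (?f b) \<or> ?f a = ?f b"
        by (auto simp: adj_def split: if_splits)
    qed
    with ij show ?thesis by auto
  qed
qed

lemma acyc_split:
  assumes v: "v \<in> B"
  shows "acyc B E \<longleftrightarrow> (\<forall>C\<in>blocks (reach (B - {v}) E) (B - {v}). acyc (insert v C) E)"
proof (intro iffI ballI)
  fix C assume a: "acyc B E" and C: "C \<in> blocks (reach (B - {v}) E) (B - {v})"
  have sub: "insert v C \<subseteq> B" using blocks_subset[OF C] v by auto
  then have "reach (B - {w}) E x y" if "reach (insert v C - {w}) E x y" for w x y
    using that sub by (elim reach_mono) auto
  with a sub show "acyc (insert v C) E" unfolding acyc_def by blast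
next
  assume a: "\<forall>C\<in>blocks (reach (B - {v}) E) (B - {v}). acyc (insert v C) E"
  show "acyc B E"
    unfolding acyc_def
  proof (intro ballI impI notI)
    fix u x y assume u: "u \<in> B" "x \<in> B - {u}" "y \<in> B - {u}"
      "{u, x} \<in> E \<and> {u, y} \<in> E \<and> x \<noteq> y" "reach (B - {u}) E x y"
    \<comment> \<open>\<open>z\<close> picks the component whose block contains \<open>u\<close>,
      \<open>x\<close> and \<open>y\<close>: for \<open>u = v\<close> that of \<open>x\<close>,
      which also contains \<open>y\<close>; otherwise that of \<open>u\<close>, where each of
      \<open>x\<close> and \<open>y\<close> is a member or equal to \<open>v\<close>.\<close>
    define z where "z = (if u = v then x else u)"
    define C where "C = {y \<in> B - {v}. reach (B - {v}) E z y}"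
    have z: "z \<in> B - {v}" using u by (auto simp: z_def)
    then have C: "C \<in> blocks (reach (B - {v}) E) (B - {v})"
      by (auto simp: C_def blocks_def)
    have "u \<in> insert v C \<and> x \<in> insert v C \<and> y \<in> insert v C"
    proof (cases "u = v")
      case True
      with u z show ?thesis by (auto simp: C_def z_def)
    next
      case False
      with u z show ?thesis by (auto simp: C_def z_def adj_def)
    qed
    moreover from this have "reach (insert v C - {u}) E x y"
      using reach_split[OF C v, of u x y] u by auto
    ultimately have "x = y"
      using a C u by (intro acycD[of "insert v C" E u]) auto
    with u show False by simp
  qed
qed

text \<open>Among all pairs of a vertex and a component holding a majority of \<open>W\<close>, take
  one with the smallest component \<open>C\<close>. Moving from \<open>v\<close> to its neighbour
  \<open>u\<close> in \<open>C\<close>, the majority component \<open>D\<close> at \<open>u\<close>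
  meets \<open>C\<close>, because two majorities intersect, and is trapped in
  \<open>C - {u}\<close>, contradicting minimality.\<close>

lemma centroid:
  fixes m :: nat
  assumes t: "is_tree B E" and fin: "finite B" and W: "W \<subseteq> B" "card W = m"
  shows "\<exists>v\<in>B. \<forall>C\<in>blocks (reach (B - {v}) E) (B - {v}). 2 * card (C \<inter> W) \<le> m"
proof (rule ccontr)
  let ?K = "\<lambda>v. blocks (reach (B - {v}) E) (B - {v})"
  assume "\<not> ?thesis"
  then have ex: "\<forall>v\<in>B. \<exists>C\<in>?K v. m < 2 * card (C \<inter> W)" by (auto simp: not_le)
  define S where "S = {(v, C). v \<in> B \<and> C \<in> ?K v \<and> m < 2 * card (C \<inter> W)}"
  have "S \<noteq> {}" using t ex by (auto simp: S_def is_tree_iff)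
  then obtain s where s: "s \<in> S" "\<And>t. t \<in> S \<Longrightarrow> card (snd s) \<le> card (snd t)"
    using ex_has_least_nat[of "\<lambda>s. s \<in> S" _ "\<lambda>s. card (snd s)"] by blast
  obtain v C where "s = (v, C)" by force
  with s have v: "v \<in> B" and C: "C \<in> ?K v" and CW: "m < 2 * card (C \<inter> W)"
    and least: "\<And>u D. (u, D) \<in> S \<Longrightarrow> card C \<le> card D"
    by (fastforce simp: S_def)+
  have sub: "C \<subseteq> B - {v}" by (rule blocks_subset[OF C])
  have finW: "finite W" using W fin finite_subset by auto
  obtain x where x: "x \<in> C" using block_nonempty[OF equivp_reach C] by blast
  with sub t v have "reach B E x v" "x \<noteq> v" by (auto simp: is_tree_iff)
  from reach_neighbour[OF this] obtain u
    where u: "u \<in> B - {v}" "{u, v} \<in> E" "reach (B - {v}) E x u" by blast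
  have uC: "u \<in> C" using u block_eq[OF equivp_reach C x] by auto
  obtain D where D: "D \<in> ?K u" "m < 2 * card (D \<inter> W)" using ex u by auto
  have "C \<inter> D \<inter> W \<noteq> {}"
  proof
    assume "C \<inter> D \<inter> W = {}"
    then have "card ((C \<inter> W) \<union> (D \<inter> W)) = card (C \<inter> W) + card (D \<inter> W)"
      using finW by (intro card_Un_disjoint) auto
    moreover have "card ((C \<inter> W) \<union> (D \<inter> W)) \<le> card W"
      using finW by (intro card_mono) auto
    ultimately show False using CW D W by simp
  qed
  then obtain z where z: "z \<in> C" "z \<in> D" by auto
  \<comment> \<open>The only way out of \<open>C\<close> leads to \<open>v\<close>, and acyclicity
    makes \<open>u\<close> the only vertex of \<open>C\<close> adjacent to \<open>v\<close>. A walk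
    avoiding \<open>u\<close> stays inside.\<close>
  have "y \<in> C - {u}" if "reach (B - {u}) E z y" for y
    using that
  proof (induction rule: rtranclp_induct)
    case base
    then show ?case using z blocks_subset[OF D(1)] by auto
  next
    case (step y y')
    have "y' \<noteq> v"
    proof
      assume "y' = v"
      moreover have "reach (B - {v}) E y u"
        using step block_eq[OF equivp_reach C, of y] uC by auto
      ultimately have "y = u"
        using step u v t sub by (intro acycD[of B E v]) (auto simp: adj_def is_tree_iff insert_commute)
      with step show False by simp
    qed
    then have "adj (B - {v}) E y y'" using step sub by (auto simp: adj_def)
    then show ?case
      using step block_eq[OF equivp_reach C, of y] by (auto simp: adj_def)
  qed
  then have "D \<subseteq> C - {u}" using block_eq[OF equivp_reach D(1) z(2)] by auto
  then have "card D < card C"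
    using uC sub fin by (intro psubset_card_mono) (auto intro: finite_subset)
  moreover have "(u, D) \<in> S" using u D by (auto simp: S_def)
  ultimately show False using least by force
qed

section \<open>Inverse covariance on an index set\<close>

text \<open>Matrices become functions on an index set: a principal submatrix is the same function on
  a smaller set, and the recursion needs no renumbering.\<close>

definition spd_on :: "nat set \<Rightarrow> (nat \<Rightarrow> nat \<Rightarrow> real) \<Rightarrow> bool" where
  "spd_on B S \<longleftrightarrow> (\<forall>i\<in>B. \<forall>j\<in>B. S i j = S j i) \<and>
     (\<forall>z. (\<exists>i\<in>B. z i \<noteq> 0) \<longrightarrow> 0 < (\<Sum>i\<in>B. \<Sum>j\<in>B. z i * S i j * z j))"

text \<open>For symmetric \<open>S\<close>, symmetry of \<open>K\<close> turns the left inverse into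
  a right inverse by transposition.\<close>

definition inverse_on :: "nat set \<Rightarrow> (nat \<Rightarrow> nat \<Rightarrow> real) \<Rightarrow> (nat \<Rightarrow> nat \<Rightarrow> real) \<Rightarrow> bool" where
  "inverse_on B S K \<longleftrightarrow> (\<forall>i\<in>B. \<forall>j\<in>B. K i j = K j i) \<and>
     (\<forall>i\<in>B. \<forall>j\<in>B. (\<Sum>x\<in>B. K i x * S x j) = (if i = j then 1 else 0))"

lemma spd_on_sym: "spd_on B S \<Longrightarrow> i \<in> B \<Longrightarrow> j \<in> B \<Longrightarrow> S i j = S j i"
  by (simp add: spd_on_def)

lemma spd_on_pos:
  assumes "spd_on B S" "i \<in> B" "z i \<noteq> 0"
  shows "0 < (\<Sum>i\<in>B. \<Sum>j\<in>B. z i * S i j * z j)"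
  using assms unfolding spd_on_def by blast

lemma inverse_on_sym: "inverse_on B S K \<Longrightarrow> i \<in> B \<Longrightarrow> j \<in> B \<Longrightarrow> K i j = K j i"
  by (simp add: inverse_on_def)

lemma inverse_on_sum: "inverse_on B S K \<Longrightarrow> i \<in> B \<Longrightarrow> j \<in> B \<Longrightarrow>
    (\<Sum>x\<in>B. K i x * S x j) = (if i = j then 1 else 0)"
  unfolding inverse_on_def by blast

lemma spd_on_subset:
  assumes "spd_on B S" "A \<subseteq> B" "finite B"
  shows "spd_on A S"
  unfolding spd_on_def
proof (intro conjI allI impI)
  fix z :: "nat \<Rightarrow> real" assume z: "\<exists>i\<in>A. z i \<noteq> 0"
  define y where "y i = (if i \<in> A then z i else 0)" for i
  have "0 < (\<Sum>i\<in>B. \<Sum>j\<in>B. y i * S i j * y j)"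
    using assms z spd_on_pos[OF assms(1), of _ y] by (auto simp: y_def)
  also have "\<dots> = (\<Sum>i\<in>B. \<Sum>j\<in>A. y i * S i j * y j)"
    using assms by (intro sum.cong[OF refl] sum.mono_neutral_right) (auto simp: y_def)
  also have "\<dots> = (\<Sum>i\<in>A. \<Sum>j\<in>A. y i * S i j * y j)"
    using assms by (intro sum.mono_neutral_right) (auto simp: y_def)
  also have "\<dots> = (\<Sum>i\<in>A. \<Sum>j\<in>A. z i * S i j * z j)"
    by (simp add: y_def)
  finally show "0 < (\<Sum>i\<in>A. \<Sum>j\<in>A. z i * S i j * z j)" .
qed (use assms in \<open>auto simp: spd_on_def subset_iff\<close>)

text \<open>Principal submatrices of the inverse are positive definite, hence injective.\<close>

lemma inverse_on_block_inj:
  assumes "finite B" and S: "spd_on B S" and K: "inverse_on B S K" and X: "X \<subseteq> B"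
    and y: "\<And>i. i \<in> X \<Longrightarrow> (\<Sum>x\<in>X. K i x * y x) = 0" and "x \<in> X"
  shows "y x = 0"
proof -
  define u where "u x = (if x \<in> X then y x else 0)" for x
  define z where "z i = (\<Sum>x\<in>B. K i x * u x)" for i
  have Sz: "(\<Sum>i\<in>B. S j i * z i) = u j" if j: "j \<in> B" for j
  proof -
    have "(\<Sum>i\<in>B. S j i * z i) = (\<Sum>i\<in>B. \<Sum>x\<in>B. u x * (K x i * S i j))"
      unfolding z_def sum_distrib_left
      using j spd_on_sym[OF S, of j] inverse_on_sym[OF K] by (intro sum.cong refl) simp
    also have "\<dots> = (\<Sum>x\<in>B. u x * (\<Sum>i\<in>B. K x i * S i j))"
      by (subst sum.swap) (simp add: sum_distrib_left)
    also have "\<dots> = u j"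
      using j \<open>finite B\<close> inverse_on_sum[OF K _ j]
      by (simp add: if_distrib[of "\<lambda>x. _ * x"] cong: if_cong sum.cong)
    finally show ?thesis .
  qed
  have z0: "z i = 0" if "i \<in> X" for i
  proof -
    have "z i = (\<Sum>x\<in>X. K i x * u x)"
      unfolding z_def using X \<open>finite B\<close> by (intro sum.mono_neutral_right) (auto simp: u_def)
    also have "\<dots> = (\<Sum>x\<in>X. K i x * y x)" by (simp add: u_def)
    finally show ?thesis using y[OF that] by simp
  qed
  \<comment> \<open>Here \<open>z = K u\<close> and \<open>u = S z\<close>. As \<open>u\<close>
    lives on \<open>X\<close> and \<open>z\<close> vanishes there, the quadratic form of
    \<open>S\<close> at \<open>z\<close> is 0.\<close>
  have "(\<Sum>i\<in>B. \<Sum>j\<in>B. z i * S i j * z j) = (\<Sum>i\<in>B. z i * u i)"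
    using Sz by (simp add: mult.assoc flip: sum_distrib_left)
  also have "\<dots> = 0"
    using z0 by (intro sum.neutral) (auto simp: u_def)
  finally have "\<forall>i\<in>B. z i = 0"
    using spd_on_pos[OF S, of _ z] by auto
  then have "u x = 0" using Sz[of x] X \<open>x \<in> X\<close> by force
  then show ?thesis using \<open>x \<in> X\<close> by (simp add: u_def)
qed

text \<open>Rows \<open>X\<close> of \<open>K\<close> are supported on \<open>X\<close> and
  \<open>v\<close>. Eliminating the column of \<open>K\<close> at \<open>v\<close> between columns
  \<open>j\<close> and \<open>v\<close> of \<open>K S = 1\<close> shows that the block of
  \<open>K\<close> on \<open>X\<close> annihilates the vector
  \<open>S x j * S v v - S x v * S v j\<close>, and that block is injective.\<close>

lemma inverse_on_separated:
  assumes "finite B" "spd_on B S" and K: "inverse_on B S K" and "X \<subseteq> B" "v \<in> B - X" "j \<in> B - X" "j \<noteq> v"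
    and zero: "\<And>x w. x \<in> X \<Longrightarrow> w \<in> B - X - {v} \<Longrightarrow> K x w = 0" and "i \<in> X"
  shows "S i j * S v v = S i v * S v j"
proof -
  have split: "(\<Sum>x\<in>X. K i x * S x w) + K i v * S v w = 0" if "w \<in> {v, j}" "i \<in> X" for i w
  proof -
    have "(\<Sum>x\<in>B. K i x * S x w) = (\<Sum>x\<in>insert v X. K i x * S x w)"
      using assms zero that by (intro sum.mono_neutral_right) auto
    also have "\<dots> = (\<Sum>x\<in>X. K i x * S x w) + K i v * S v w"
      using assms finite_subset[OF assms(4,1)] by (subst sum.insert) auto
    finally show ?thesis
      using inverse_on_sum[OF K, of i w] assms(4-7) that by auto
  qed
  have "S i j * S v v - S i v * S v j = 0"
  proof (rule inverse_on_block_inj[OF assms(1-4) _ \<open>i \<in> X\<close>])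
    fix i assume i: "i \<in> X"
    have "(\<Sum>x\<in>X. K i x * (S x j * S v v - S x v * S v j))
      = (\<Sum>x\<in>X. K i x * S x j) * S v v - (\<Sum>x\<in>X. K i x * S x v) * S v j"
      by (simp add: sum_subtractf sum_distrib_right right_diff_distrib mult.assoc)
    also have "\<dots> = 0"
      using split[of j i] split[of v i] i by (simp add: eq_neg_iff_add_eq_0[symmetric])
    finally show "(\<Sum>x\<in>X. K i x * (S x j * S v v - S x v * S v j)) = 0" .
  qed
  then show ?thesis by simp
qed

text \<open>The same argument with no separating vertex: the block of \<open>K\<close> on
  \<open>X\<close> annihilates column \<open>j\<close> of \<open>S\<close>.\<close>

lemma inverse_on_disconnected:
  assumes "finite B" "spd_on B S" and K: "inverse_on B S K" and "X \<subseteq> B" "j \<in> B - X"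
    and zero: "\<And>x w. x \<in> X \<Longrightarrow> w \<in> B - X \<Longrightarrow> K x w = 0" and "i \<in> X"
  shows "S i j = 0"
proof (rule inverse_on_block_inj[OF assms(1-4) _ \<open>i \<in> X\<close>])
  fix i assume i: "i \<in> X"
  have "(\<Sum>x\<in>X. K i x * S x j) = (\<Sum>x\<in>B. K i x * S x j)"
    using assms zero i by (intro sum.mono_neutral_left) auto
  also have "\<dots> = 0"
    using inverse_on_sum[OF K, of i j] assms(4,5) i by auto
  finally show "(\<Sum>x\<in>X. K i x * S x j) = 0" .
qed

text \<open>Marginalizing out everything that \<open>v\<close> separates from \<open>C\<close> changes the inverse only at
  position \<open>(v, v)\<close>.\<close>

lemma inverse_on_restrict:
  assumes fin: "finite B" and K: "inverse_on B S K" and v: "v \<in> B" and C: "C \<subseteq> B - {v}"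
    and S: "\<And>i j. i \<in> B \<Longrightarrow> j \<in> B \<Longrightarrow> S i j = S j i" "S v v \<noteq> 0"
    and K0: "\<And>c d. c \<in> C \<Longrightarrow> d \<in> B - {v} - C \<Longrightarrow> K c d = 0"
    and S0: "\<And>c d. c \<in> C \<Longrightarrow> d \<in> B - {v} - C \<Longrightarrow> S c d * S v v = S c v * S v d"
  shows "\<exists>K'. inverse_on (insert v C) S K' \<and> (\<forall>i j. i \<noteq> j \<longrightarrow> K' i j = K i j)"
proof -
  define D where "D = B - {v} - C"
  \<comment> \<open>For \<open>d\<close> in \<open>D\<close>, separation makes row \<open>d\<close>
    of \<open>S\<close> on \<open>insert v C\<close> equal to \<open>S v d / S v v\<close> times row
    \<open>v\<close>. The terms over \<open>D\<close> in row \<open>v\<close> of the product thus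
    collapse to a multiple of \<open>S v j\<close>, absorbed by the entry \<open>(v, v)\<close>;
    rows in \<open>C\<close> have no such terms.\<close>
  define K' where "K' i x = K i x + (if i = v \<and> x = v then \<Sum>d\<in>D. K v d * (S v d / S v v) else 0)" for i x
  have B: "B = insert v C \<union> D" and disj: "insert v C \<inter> D = {}" and fins: "finite D" "finite C" and vC: "v \<notin> C"
    using v C fin by (auto simp: D_def intro: finite_subset)
  have "(\<Sum>x\<in>insert v C. K' i x * S x j) = (\<Sum>x\<in>B. K i x * S x j)"
    if i: "i \<in> insert v C" and j: "j \<in> insert v C" for i j
  proof -
    have Sd: "S d j = S v d / S v v * S v j" if "d \<in> D" for d
    proof (cases "j = v")
      case True
      then show ?thesis using S that v by (auto simp: D_def)
    next
      case False
      then have "S j d * S v v = S j v * S v d" using S0 j that by (auto simp: D_def)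
      moreover have "S j d = S d j" "S j v = S v j" using S(1) that j C v by (auto simp: D_def)
      ultimately show ?thesis using S(2) by (simp add: field_simps)
    qed
    have "(\<Sum>x\<in>B. K i x * S x j) = (\<Sum>x\<in>insert v C. K i x * S x j) + (\<Sum>d\<in>D. K i d * S d j)"
      unfolding B using disj fins by (intro sum.union_disjoint) auto
    also have "(\<Sum>d\<in>D. K i d * S d j) = (\<Sum>d\<in>D. K i d * (S v d / S v v)) * S v j"
      unfolding sum_distrib_right using Sd by (intro sum.cong) auto
    also have "\<dots> = (if i = v then \<Sum>d\<in>D. K v d * (S v d / S v v) else 0) * S v j"
    proof (cases "i = v")
      case False
      then have "K i d = 0" if "d \<in> D" for d using K0 i that by (auto simp: D_def)
      then show ?thesis using False by simp
    qed simp
    also have "(\<Sum>x\<in>insert v C. K i x * S x j) + \<dots> = (\<Sum>x\<in>insert v C. K' i x * S x j)"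
    proof -
      have "(\<Sum>x\<in>C. K' i x * S x j) = (\<Sum>x\<in>C. K i x * S x j)"
        using vC by (intro sum.cong) (auto simp: K'_def)
      then show ?thesis using fins vC by (simp add: K'_def[of i v] algebra_simps)
    qed
    finally show ?thesis by simp
  qed
  moreover have "insert v C \<subseteq> B" using v C by auto
  ultimately have "inverse_on (insert v C) S K'"
    using inverse_on_sum[OF K] unfolding inverse_on_def
    by (intro conjI ballI) (auto simp: K'_def subset_iff intro: inverse_on_sym[OF K])
  then show ?thesis by (intro exI[of _ K']) (auto simp: K'_def)
qed

section \<open>The graph of the inverse\<close>

definition kernel_edges :: "nat set \<Rightarrow> (nat \<Rightarrow> nat \<Rightarrow> real) \<Rightarrow> nat set set" where
  "kernel_edges B K = {{i, j} | i j. i \<in> B \<and> j \<in> B \<and> i \<noteq> j \<and> K i j \<noteq> 0}"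

lemma kernel_edges_iff:
  assumes "inverse_on B S K" "i \<in> B" "j \<in> B"
  shows "{i, j} \<in> kernel_edges B K \<longleftrightarrow> i \<noteq> j \<and> K i j \<noteq> 0"
  using assms inverse_on_sym[OF assms] by (auto simp: kernel_edges_def doubleton_eq_iff)

text \<open>The support of the inverse may miss edges of \<open>E\<close>, but not if either graph is a tree.\<close>

lemma is_tree_kernel_edges:
  assumes fin: "finite B" and S: "spd_on B S" and K: "inverse_on B S K"
    and loop: "\<And>i. {i} \<notin> E"
    and zero: "\<And>i j. i \<in> B \<Longrightarrow> j \<in> B \<Longrightarrow> i \<noteq> j \<Longrightarrow> {i, j} \<notin> E \<Longrightarrow> K i j = 0"
    and nz: "\<And>i j. i \<in> B \<Longrightarrow> j \<in> B \<Longrightarrow> S i j \<noteq> 0"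
    and sep: "\<And>v i j. v \<in> B \<Longrightarrow> i \<in> B - {v} \<Longrightarrow> j \<in> B - {v} \<Longrightarrow> i \<noteq> j \<Longrightarrow>
       S i j * S v v = S i v * S v j \<Longrightarrow> \<not> reach (B - {v}) E i j"
  shows "is_tree B (kernel_edges B K) \<longleftrightarrow> is_tree B E"
proof -
  let ?H = "kernel_edges B K"
  note H = kernel_edges_iff[OF K]
  have *: "is_tree B ?H \<longleftrightarrow> is_tree B E" if "\<And>i j. i \<in> B \<Longrightarrow> j \<in> B \<Longrightarrow> {i, j} \<in> E \<Longrightarrow> K i j \<noteq> 0"
    using that zero loop by (intro is_tree_cong) (auto simp: H)
  have "K i j \<noteq> 0" if t: "is_tree B E" and ij: "i \<in> B" "j \<in> B" "{i, j} \<in> E" for i j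
  proof
    assume K0: "K i j = 0"
    have "i \<noteq> j" using ij loop[of i] by auto
    \<comment> \<open>\<open>X\<close> is the side of \<open>i\<close> after deleting
      \<open>j\<close>. By acyclicity \<open>{i, j}\<close> is the only edge between
      \<open>X\<close> and the rest, so \<open>K i j = 0\<close> decouples \<open>X\<close> and
      forces \<open>S i j = 0\<close>.\<close>
    define X where "X = {x \<in> B - {j}. reach (B - {j}) E i x}"
    have "S i j = 0"
    proof (rule inverse_on_disconnected[OF fin S K, of X])
      fix x w assume x: "x \<in> X" and w: "w \<in> B - X"
      show "K x w = 0"
      proof (cases "w = j")
        case True
        show ?thesis
        proof (cases "{x, j} \<in> E")
          case True
          then have "i = x"
            using t ij x \<open>i \<noteq> j\<close> by (intro acycD[of B E j]) (auto simp: is_tree_iff X_def insert_commute)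
          with K0 \<open>w = j\<close> show ?thesis by simp
        next
          case False
          with x \<open>w = j\<close> ij show ?thesis by (intro zero) (auto simp: X_def)
        qed
      next
        case False
        have "{x, w} \<notin> E"
        proof
          assume "{x, w} \<in> E"
          then have "adj (B - {j}) E x w" using x w False by (auto simp: X_def adj_def)
          with x have "reach (B - {j}) E i w" by (auto simp: X_def)
          with w False show False by (auto simp: X_def)
        qed
        with x w show ?thesis by (intro zero) (auto simp: X_def)
      qed
    qed (use ij \<open>i \<noteq> j\<close> in \<open>auto simp: X_def\<close>)
    with nz ij show False by simp
  qed
  moreover have "K i j \<noteq> 0" if t: "is_tree B ?H" and ij: "i \<in> B" "j \<in> B" "{i, j} \<in> E" for i j
  proof
    assume K0: "K i j = 0"
    have "i \<noteq> j" using ij loop[of i] by auto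
    have "reach B ?H j i" using t ij by (auto simp: is_tree_iff)
    from reach_neighbour[OF this] \<open>i \<noteq> j\<close> obtain v
      where v: "v \<in> B - {i}" "{v, i} \<in> ?H" "reach (B - {i}) ?H j v" by blast
    have "v \<noteq> j" using v K0 inverse_on_sym[OF K ij(1,2)] by (auto simp: H ij)
    from reach_neighbour[OF v(3)] this obtain u
      where u: "u \<in> B - {i} - {v}" "{u, v} \<in> ?H" "reach (B - {i} - {v}) ?H j u" by blast
    \<comment> \<open>\<open>v\<close> is the neighbour of \<open>i\<close> towards \<open>j\<close>
      in the support graph, and \<open>u\<close> the neighbour of \<open>v\<close> on the side of
      \<open>j\<close>. If \<open>i\<close> reached \<open>j\<close> without \<open>v\<close>, then
      \<open>i\<close> and \<open>u\<close> would close a cycle through \<open>v\<close>. So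
      \<open>v\<close> separates \<open>i\<close> from \<open>j\<close> in the support graph and the
      Schur entry vanishes, although \<open>{i, j}\<close> is an edge of \<open>E\<close> avoiding
      \<open>v\<close>.\<close>
    define X where "X = {x \<in> B - {v}. reach (B - {v}) ?H i x}"
    have jX: "j \<notin> X"
    proof
      assume "j \<in> X"
      moreover have "reach (B - {v}) ?H j u" using u(3) by (rule reach_mono) auto
      ultimately have "reach (B - {v}) ?H i u" by (auto simp: X_def)
      then have "i = u"
        using t ij u v by (intro acycD[of B ?H v]) (auto simp: is_tree_iff insert_commute)
      with u show False by simp
    qed
    have "S i j * S v v = S i v * S v j"
    proof (rule inverse_on_separated[OF fin S K, of X])
      fix x w assume x: "x \<in> X" and w: "w \<in> B - X - {v}"
      show "K x w = 0"
      proof (rule ccontr)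
        assume "K x w \<noteq> 0"
        with x w have "adj (B - {v}) ?H x w" by (auto simp: X_def adj_def H)
        with x have "reach (B - {v}) ?H i w" by (auto simp: X_def)
        with w show False by (auto simp: X_def)
      qed
    qed (use ij v jX \<open>v \<noteq> j\<close> in \<open>auto simp: X_def\<close>)
    moreover have "adj (B - {v}) E i j" using ij v \<open>v \<noteq> j\<close> by (auto simp: adj_def)
    ultimately show False using sep[of v i j] ij v \<open>v \<noteq> j\<close> \<open>i \<noteq> j\<close> by auto
  qed
  ultimately show ?thesis using * by blast
qed

text \<open>A one-sided inverse over a field determines the computed inverse, so exhibiting
  \<open>L\<close> is enough.\<close>

lemma mat_inverse_eqI:
  fixes A :: "'a :: field mat"
  assumes A: "A \<in> carrier_mat n n" and L: "L \<in> carrier_mat n n" and LA: "L * A = 1\<^sub>m n"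
  shows "mat_inverse A = Some L"
proof -
  have "det L * det A = 1"
    using det_mult[OF L A] LA by simp
  then have "det A \<noteq> 0" by auto
  then obtain M where M: "mat_inverse A = Some M"
    using det_non_zero_imp_unit[OF A] mat_inverse(1)[OF A] by fastforce
  from mat_inverse(2)[OF A M] have AM: "A * M = 1\<^sub>m n" "M \<in> carrier_mat n n" by auto
  have "M = (L * A) * M" using AM LA by simp
  also have "\<dots> = L" using assoc_mult_mat[OF L A AM(2)] AM L by simp
  finally show ?thesis using M by simp
qed

text \<open>The map \<open>(!) xs\<close> is an isomorphism from row positions to vertices; the
  computed inverse is \<open>K\<close> written in positions.\<close>

lemma is_tree_support_edges:
  assumes fin: "finite B" and K: "inverse_on B S K"
  defines "xs \<equiv> sorted_list_of_set B"
  shows "is_tree {..<card B} (support_edges (the (mat_inverse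
      (mat_of_rows_list (card B) (map (\<lambda>i. map (\<lambda>j. S i j) xs) xs))))) \<longleftrightarrow> is_tree B (kernel_edges B K)"
proof -
  let ?n = "card B"
  define L where "L = mat ?n ?n (\<lambda>(a, b). K (xs ! a) (xs ! b))"
  let ?M = "mat_of_rows_list ?n (map (\<lambda>i. map (\<lambda>j. S i j) xs) xs)"
  have len: "length xs = ?n" and set: "set xs = B" and dist: "distinct xs"
    using fin by (simp_all add: xs_def)
  have bij: "bij_betw ((!) xs) {..<?n} B"
    using dist by (intro bij_betw_nth) (simp_all add: len set)
  have inB: "xs ! a \<in> B" if "a < ?n" for a using that len set nth_mem by metis
  have inj: "xs ! a = xs ! b \<longleftrightarrow> a = b" if "a < ?n" "b < ?n" for a b
    using that dist len by (simp add: nth_eq_iff_index_eq)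
  have M: "?M \<in> carrier_mat ?n ?n" by (simp add: mat_of_rows_list_def len)
  have "L * ?M = 1\<^sub>m ?n"
  proof (rule eq_matI)
    fix a b assume "a < dim_row (1\<^sub>m ?n :: real mat)" "b < dim_col (1\<^sub>m ?n :: real mat)"
    then have ab: "a < ?n" "b < ?n" by simp_all
    then have "(L * ?M) $$ (a, b) = (\<Sum>c<?n. K (xs ! a) (xs ! c) * S (xs ! c) (xs ! b))"
      by (simp add: L_def mat_of_rows_list_def len scalar_prod_def row_def col_def atLeast0LessThan)
    also have "\<dots> = (\<Sum>x\<in>B. K (xs ! a) x * S x (xs ! b))"
      by (rule sum.reindex_bij_betw[OF bij])
    also have "\<dots> = 1\<^sub>m ?n $$ (a, b)"
      using ab inverse_on_sum[OF K] inB inj by simp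
    finally show "(L * ?M) $$ (a, b) = 1\<^sub>m ?n $$ (a, b)" .
  qed (simp_all add: L_def mat_of_rows_list_def)
  then have inv: "mat_inverse ?M = Some L" by (intro mat_inverse_eqI[OF M]) (simp_all add: L_def)
  have e: "{xs ! a, xs ! b} \<in> kernel_edges B K \<longleftrightarrow> {a, b} \<in> support_edges L" if "a < ?n" "b < ?n" for a b
  proof -
    have "{a, b} \<in> support_edges L \<longleftrightarrow> a \<noteq> b \<and> K (xs ! a) (xs ! b) \<noteq> 0"
    proof
      show "{a, b} \<in> support_edges L \<Longrightarrow> a \<noteq> b \<and> K (xs ! a) (xs ! b) \<noteq> 0"
        using that inverse_on_sym[OF K inB inB] by (auto simp: support_edges_def L_def doubleton_eq_iff)
      show "a \<noteq> b \<and> K (xs ! a) (xs ! b) \<noteq> 0 \<Longrightarrow> {a, b} \<in> support_edges L"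
        unfolding support_edges_def mem_Collect_eq
        using that by (intro exI[of _ a] exI[of _ b]) (auto simp: L_def)
    qed
    then show ?thesis using that kernel_edges_iff[OF K inB inB] inj by simp
  qed
  have bij': "bij_betw (inv_into {..<?n} ((!) xs)) B {..<?n}"
    by (rule bij_betw_inv_into[OF bij])
  have "is_tree {..<?n} (support_edges L) \<longleftrightarrow> is_tree B (kernel_edges B K)"
  proof
    show "is_tree {..<?n} (support_edges L) \<Longrightarrow> is_tree B (kernel_edges B K)"
      using e by (intro is_tree_image[OF bij]) auto
    show "is_tree B (kernel_edges B K) \<Longrightarrow> is_tree {..<?n} (support_edges L)"
    proof (erule is_tree_image[OF bij', rotated])
      fix x y assume "x \<in> B" "y \<in> B"
      then obtain a b where "a < ?n" "b < ?n" "x = xs ! a" "y = xs ! b"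
        using set len by (metis in_set_conv_nth)
      with e[of a b] show "{inv_into {..<?n} ((!) xs) x, inv_into {..<?n} ((!) xs) y} \<in> support_edges L
          \<longleftrightarrow> {x, y} \<in> kernel_edges B K"
        using bij_betw_imp_inj_on[OF bij] by (simp add: inv_into_f_f)
    qed
  qed
  with inv show ?thesis by simp
qed

section \<open>Faithfulness\<close>

text \<open>A nonzero entry is a nonzero minor of order one.\<close>

lemma rank_pos:
  fixes A :: "'a :: field mat"
  assumes "r < dim_row A" "c < dim_col A" "A $$ (r, c) \<noteq> 0"
  shows "vec_space.rank (dim_row A) A \<ge> 1"
proof -
  have I: "{i. i < dim_row A \<and> i \<in> {r}} = {r}" "{j. j < dim_col A \<and> j \<in> {c}} = {c}"
    using assms by auto
  have "submatrix A {r} {c} \<in> carrier_mat 1 1"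
    by (intro carrier_matI) (simp_all only: dim_submatrix I, simp_all)
  then have "det (submatrix A {r} {c}) = submatrix A {r} {c} $$ (0, 0)" by (rule det_single)
  also have "\<dots> = A $$ (r, c)"
  proof -
    have "{a. a = r \<and> a < r} = {}" "{a. a = c \<and> a < c} = {}" by auto
    with submatrix_index_card[of r A c "{r}" "{c}"] assms show ?thesis by simp
  qed
  finally have "det (submatrix A {r} {c}) \<noteq> 0" using assms by simp
  from vec_space.rank_gt_minor[OF _ this, of "dim_row A" "dim_col A"] I show ?thesis by simp
qed

lemma rank_entry_iff:
  fixes \<Sigma> :: "real mat"
  assumes \<Sigma>: "\<Sigma> \<in> carrier_mat n n" and ij: "i < n" "j < n"
  shows "mat_rank (submatrix \<Sigma> {i} {j}) = 0 \<longleftrightarrow> \<Sigma> $$ (i, j) = 0"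
proof -
  let ?A = "submatrix \<Sigma> {i} {j}"
  have I: "{a. a < dim_row \<Sigma> \<and> a \<in> {i}} = {i}" "{a. a < dim_col \<Sigma> \<and> a \<in> {j}} = {j}"
    using assms by auto
  have dim: "dim_row ?A = 1" "dim_col ?A = 1" by (simp_all only: dim_submatrix I) simp_all
  have e: "?A $$ (0, 0) = \<Sigma> $$ (i, j)"
  proof -
    have "{a. a = i \<and> a < i} = {}" "{a. a = j \<and> a < j} = {}" by auto
    with submatrix_index_card[of i \<Sigma> j "{i}" "{j}"] assms show ?thesis by simp
  qed
  show ?thesis
  proof
    assume "\<Sigma> $$ (i, j) = 0"
    with e dim have "?A = 0\<^sub>m 1 1" by (intro eq_matI) auto
    then show "mat_rank ?A = 0" using vec_space.rank_0I[where ?'a = real, of 1 1] by simp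
  next
    assume "mat_rank ?A = 0"
    then show "\<Sigma> $$ (i, j) = 0" using rank_pos[of 0 ?A 0] dim e by fastforce
  qed
qed

text \<open>Cramer's rule for a nonzero kernel vector. Unlike an expanded determinant, it is
  insensitive to the order in which rows and columns are listed.\<close>

lemma singular_2x2:
  fixes a b c d x y :: "'a :: idom"
  assumes "x \<noteq> 0 \<or> y \<noteq> 0" "a * x + b * y = 0" "c * x + d * y = 0"
  shows "a * d = b * c"
proof -
  have "(a * d - b * c) * x = d * (a * x + b * y) - b * (c * x + d * y)"
    "(a * d - b * c) * y = a * (c * x + d * y) - c * (a * x + b * y)"
    by (simp_all add: algebra_simps)
  with assms show ?thesis by auto
qed

lemma rank_schur_iff:
  fixes \<Sigma> :: "real mat"
  assumes \<Sigma>: "\<Sigma> \<in> carrier_mat n n" and ij: "i < n" "j < n" "v < n" "i \<noteq> v" "j \<noteq> v" and nz: "\<Sigma> $$ (v, v) \<noteq> 0"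
  shows "mat_rank (submatrix \<Sigma> {i, v} {j, v}) = 1 \<longleftrightarrow>
    \<Sigma> $$ (i, j) * \<Sigma> $$ (v, v) = \<Sigma> $$ (i, v) * \<Sigma> $$ (v, j)"
proof -
  let ?A = "submatrix \<Sigma> {i, v} {j, v}"
  have I: "{a. a < dim_row \<Sigma> \<and> a \<in> {i, v}} = {i, v}" "{a. a < dim_col \<Sigma> \<and> a \<in> {j, v}} = {j, v}"
    using assms by auto
  have dim: "dim_row ?A = 2" "dim_col ?A = 2" by (simp_all only: dim_submatrix I) (use ij in simp_all)
  \<comment> \<open>Submatrices list indices in increasing order, so \<open>p a b\<close> is the
    position of \<open>a\<close> in \<open>{a, b}\<close>. This treats all orders of
    \<open>i\<close>, \<open>j\<close>, \<open>v\<close> at once.\<close>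
  define p where "p = (\<lambda>a b :: nat. if b < a then 1 else 0 :: nat)"
  have p: "card {c \<in> {a, b}. c < a} = p a b" "card {c \<in> {a, b}. c < b} = p b a" for a b
  proof -
    have "{c \<in> {a, b}. c < a} = (if b < a then {b} else {})" "{c \<in> {a, b}. c < b} = (if a < b then {a} else {})"
      by auto
    then show "card {c \<in> {a, b}. c < a} = p a b" "card {c \<in> {a, b}. c < b} = p b a"
      by (simp_all add: p_def)
  qed
  note ix = submatrix_index_card[of _ \<Sigma> _ "{i, v}" "{j, v}"]
  have e: "?A $$ (p i v, p j v) = \<Sigma> $$ (i, j)" "?A $$ (p i v, p v j) = \<Sigma> $$ (i, v)"
    "?A $$ (p v i, p j v) = \<Sigma> $$ (v, j)" "?A $$ (p v i, p v j) = \<Sigma> $$ (v, v)"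
    using ix[of i j] ix[of i v] ix[of v j] ix[of v v] assms unfolding p by auto
  have plt: "p a b < 2" for a b by (simp add: p_def)
  show ?thesis
  proof
    assume r: "mat_rank ?A = 1"
    have A: "?A \<in> carrier_mat 2 2" using dim by auto
    have "det ?A = 0"
      using vec_space.low_rank_det_zero[OF A] r dim by fastforce
    then obtain x where x: "x \<in> carrier_vec 2" "x \<noteq> 0\<^sub>v 2" "?A *\<^sub>v x = 0\<^sub>v 2"
      using det_0_iff_vec_prod_zero_field[OF A] by blast
    have row: "?A $$ (r, p j v) * x $ p j v + ?A $$ (r, p v j) * x $ p v j = 0" if "r < 2" for r
    proof -
      have "0 = (?A *\<^sub>v x) $ r" using x that by simp
      also have "\<dots> = ?A $$ (r, 0) * x $ 0 + ?A $$ (r, 1) * x $ 1"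
        using x(1) that dim by (simp add: scalar_prod_def numeral_2_eq_2 row_def)
      finally show ?thesis using ij by (auto simp: p_def)
    qed
    have ne: "x $ p j v \<noteq> 0 \<or> x $ p v j \<noteq> 0"
    proof (rule ccontr)
      assume n: "\<not> ?thesis"
      have "a < 2 \<Longrightarrow> a = p j v \<or> a = p v j" for a using ij by (auto simp: p_def)
      with n have "x $ a = 0" if "a < 2" for a using that by metis
      with x(1,2) show False by (metis carrier_vecD eq_vecI index_zero_vec)
    qed
    from row[OF plt, of i v] row[OF plt, of v i] ne e
    have "\<Sigma> $$ (i, j) * x $ p j v + \<Sigma> $$ (i, v) * x $ p v j = 0"
      "\<Sigma> $$ (v, j) * x $ p j v + \<Sigma> $$ (v, v) * x $ p v j = 0" by simp_all
    with ne show "\<Sigma> $$ (i, j) * \<Sigma> $$ (v, v) = \<Sigma> $$ (i, v) * \<Sigma> $$ (v, j)"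
      by (rule singular_2x2)
  next
    assume eq: "\<Sigma> $$ (i, j) * \<Sigma> $$ (v, v) = \<Sigma> $$ (i, v) * \<Sigma> $$ (v, j)"
    \<comment> \<open>Dividing by the corner \<open>(v, v)\<close> writes the block as column
      \<open>v\<close> times row \<open>v\<close>.\<close>
    have "mat_rank ?A \<le> 1"
    proof (rule vec_space.rank_le_1_product_entries)
      fix r c assume rc: "r < dim_row ?A" "c < dim_col ?A"
      have "pick {i, v} r \<in> {i, v}" "pick {j, v} c \<in> {j, v}"
        using rc ij by (intro pick_in_set_le; simp add: dim)+
      then show "?A $$ (r, c) = \<Sigma> $$ (pick {i, v} r, v) * (\<Sigma> $$ (v, pick {j, v} c) / \<Sigma> $$ (v, v))"
        using rc nz eq by (auto simp: submatrix_def field_simps)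
    qed auto
    moreover have "mat_rank ?A \<ge> 1"
      using rank_pos[of "p v i" ?A "p v j"] plt dim e nz by simp
    ultimately show "mat_rank ?A = 1" by simp
  qed
qed

text \<open>Faithfulness is applied to singletons: an empty separator, with connectedness, gives
  nonzero entries, and the separator \<open>{v}\<close> gives the Schur criterion.\<close>

lemma faithful_model_entries:
  assumes "\<Sigma> \<in> faithful_model 1 n E" "graph_connected {..<n} E"
  defines "S \<equiv> \<lambda>i j. \<Sigma> $$ (i, j)"
  shows "spd_on {..<n} S"
    and "\<exists>K. inverse_on {..<n} S K \<and> (\<forall>i<n. \<forall>j<n. i \<noteq> j \<and> {i, j} \<notin> E \<longrightarrow> K i j = 0)"
    and "\<And>i j. i < n \<Longrightarrow> j < n \<Longrightarrow> S i j \<noteq> 0"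
    and "\<And>i j v. i < n \<Longrightarrow> j < n \<Longrightarrow> v < n \<Longrightarrow> i \<noteq> v \<Longrightarrow> j \<noteq> v \<Longrightarrow>
      S i j * S v v = S i v * S v j \<longleftrightarrow> \<not> reach ({..<n} - {v}) E i j"
proof -
  have \<Sigma>: "\<Sigma> \<in> carrier_mat n n" and sym: "transpose_mat \<Sigma> = \<Sigma>"
    and pd: "\<And>x. x \<in> carrier_vec n \<Longrightarrow> x \<noteq> 0\<^sub>v n \<Longrightarrow> 0 < scalar_prod x (\<Sigma> *\<^sub>v x)"
    and gm: "\<And>i j. i < n \<Longrightarrow> j < n \<Longrightarrow> i \<noteq> j \<Longrightarrow> {i, j} \<notin> E \<Longrightarrow> the (mat_inverse \<Sigma>) $$ (i, j) = 0"
    and rk: "\<And>A A' S. A \<subseteq> {..<n} \<Longrightarrow> A' \<subseteq> {..<n} \<Longrightarrow> S \<subseteq> {..<n} \<Longrightarrow> card S \<le> 1 \<Longrightarrow>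
       mat_rank (submatrix \<Sigma> (A \<union> S) (A' \<union> S)) = card S \<longleftrightarrow> separates {..<n} E S A A'"
    using assms(1) by (auto simp: faithful_model_def graph_model_def spd_mats_def)
  have symS: "S i j = S j i" if "i < n" "j < n" for i j
    using that \<Sigma> sym unfolding S_def by (metis carrier_matD index_transpose_mat(1))
  show spd: "spd_on {..<n} S"
    unfolding spd_on_def
  proof (intro conjI ballI allI impI)
    fix z :: "nat \<Rightarrow> real" assume z: "\<exists>i\<in>{..<n}. z i \<noteq> 0"
    have "0 < scalar_prod (vec n z) (\<Sigma> *\<^sub>v vec n z)"
    proof (rule pd)
      from z obtain i where "i < n" "z i \<noteq> 0" by auto
      then have "vec n z $ i \<noteq> 0\<^sub>v n $ i" by simp
      then show "vec n z \<noteq> 0\<^sub>v n" by metis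
    qed simp
    also have "\<dots> = (\<Sum>i<n. \<Sum>j<n. z i * S i j * z j)"
      using \<Sigma> by (simp add: scalar_prod_def atLeast0LessThan sum_distrib_left row_def S_def mult.assoc)
    finally show "0 < (\<Sum>i<n. \<Sum>j<n. z i * S i j * z j)" .
  qed (use symS in auto)
  show "\<exists>K. inverse_on {..<n} S K \<and> (\<forall>i<n. \<forall>j<n. i \<noteq> j \<and> {i, j} \<notin> E \<longrightarrow> K i j = 0)"
  proof -
    have "det \<Sigma> \<noteq> 0"
    proof
      assume "det \<Sigma> = 0"
      then obtain x where x: "x \<in> carrier_vec n" "x \<noteq> 0\<^sub>v n" "\<Sigma> *\<^sub>v x = 0\<^sub>v n"
        using det_0_iff_vec_prod_zero_field[OF \<Sigma>] by blast
      with pd[of x] show False by simp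
    qed
    then obtain M where M: "mat_inverse \<Sigma> = Some M"
      using det_non_zero_imp_unit[OF \<Sigma>] mat_inverse(1)[OF \<Sigma>] by fastforce
    from mat_inverse(2)[OF \<Sigma> M] have MS: "\<Sigma> * M = 1\<^sub>m n" "M * \<Sigma> = 1\<^sub>m n" and Mc: "M \<in> carrier_mat n n"
      by auto
    \<comment> \<open>Transposing yields another left inverse, so the inverse is symmetric.\<close>
    have "transpose_mat M * \<Sigma> = 1\<^sub>m n"
      using transpose_mult[OF \<Sigma> Mc] MS sym by simp
    from mat_inverse_eqI[OF \<Sigma> _ this] M Mc have Msym: "transpose_mat M = M" by simp
    have "inverse_on {..<n} S (\<lambda>i j. M $$ (i, j))"
      unfolding inverse_on_def
    proof (intro conjI ballI)
      fix i j assume "i \<in> {..<n}" "j \<in> {..<n}"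
      then have ij: "i < n" "j < n" by auto
      then show "M $$ (i, j) = M $$ (j, i)"
        using Msym Mc by (metis carrier_matD index_transpose_mat(1))
      have "(M * \<Sigma>) $$ (i, j) = (\<Sum>x<n. M $$ (i, x) * S x j)"
        using ij \<Sigma> Mc by (simp add: scalar_prod_def atLeast0LessThan S_def)
      then show "(\<Sum>x<n. M $$ (i, x) * S x j) = (if i = j then 1 else 0)"
        using MS ij by simp
    qed
    with gm M show ?thesis by (intro exI[of _ "\<lambda>i j. M $$ (i, j)"]) auto
  qed
  show nz: "S i j \<noteq> 0" if "i < n" "j < n" for i j
  proof -
    have "\<not> separates {..<n} E {} {i} {j}"
      using assms(2) that by (force simp: separates_def graph_connected_def)
    with rk[of "{i}" "{j}" "{}"] rank_entry_iff[OF \<Sigma> that] that show ?thesis by (auto simp: S_def)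
  qed
  show "S i j * S v v = S i v * S v j \<longleftrightarrow> \<not> reach ({..<n} - {v}) E i j"
    if "i < n" "j < n" "v < n" "i \<noteq> v" "j \<noteq> v" for i j v
    using rk[of "{i}" "{j}" "{v}"] rank_schur_iff[OF \<Sigma> that] nz[of v v] that
      separates_vertex_iff[of i "{..<n}" v E j] by (auto simp: S_def insert_commute)
qed

section \<open>Sampling without replacement\<close>

text \<open>Each factor (d - i) / (n - i) of the quotient is at most d / n, hence at most 1 / c. The
  induction strips one factor by absorption.\<close>

lemma binomial_scale:
  assumes "c * d \<le> n"
  shows "(d choose k) * c ^ k \<le> n choose k"
  using assms
proof (induction k arbitrary: d n)
  case (Suc k)
  show ?case
  proof (cases "d = 0 \<or> c = 0")
    case False
    have le: "c * (d - 1) \<le> n - 1"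
      using Suc.prems False unfolding diff_mult_distrib2 by linarith
    have "Suc k * ((d choose Suc k) * c ^ Suc k) = (Suc k * (d choose Suc k)) * c ^ Suc k"
      by (simp only: mult.assoc)
    also have "\<dots> = (d * ((d - 1) choose k)) * c ^ Suc k"
      by (simp only: binomial_absorption)
    also have "\<dots> = (c * d) * (((d - 1) choose k) * c ^ k)"
      by (simp add: algebra_simps)
    also have "\<dots> \<le> n * ((n - 1) choose k)"
      using Suc.prems Suc.IH[OF le] by (intro mult_mono) auto
    also have "\<dots> = Suc k * (n choose Suc k)"
      by (rule binomial_absorption[symmetric])
    finally show ?thesis by (simp only: Suc_mult_le_cancel1)
  qed auto
qed simp

text \<open>If at most half of the sample lies in \<open>C\<close>, at least \<open>k\<close> =
  ceiling of m / 2 of its points lie in the complement \<open>D\<close>. Choosing \<open>k\<close>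
  of these and completing arbitrarily covers every such sample, and \<open>choose_mult\<close>
  compares the count with that of all samples.\<close>

lemma card_half_missing:
  assumes fin: "finite B" and C: "C \<subseteq> B" "16 * card (B - C) \<le> card B" and m: "m \<le> card B"
  shows "card {W. W \<subseteq> B \<and> card W = m \<and> 2 * card (C \<inter> W) \<le> m} * 2 ^ m \<le> card B choose m"
proof -
  define k where "k = m - m div 2"
  define D where "D = B - C"
  let ?X = "{W. W \<subseteq> B \<and> card W = m \<and> 2 * card (C \<inter> W) \<le> m}"
  let ?T = "{T. T \<subseteq> D \<and> card T = k}" and ?U = "\<lambda>T. {U. U \<subseteq> B - T \<and> card U = m - k}"
  have finD: "finite D" using fin by (simp add: D_def)
  have k: "k \<le> m" "m \<le> 2 * k" by (simp_all add: k_def)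
  have "?X \<subseteq> (\<Union>T\<in>?T. (\<lambda>U. T \<union> U) ` ?U T)"
  proof
    fix W assume W: "W \<in> ?X"
    then have finW: "finite W" using fin finite_subset by auto
    have "card W = card (C \<inter> W) + card (D \<inter> W)"
      using W finW by (subst card_Un_disjoint[symmetric]) (auto simp: D_def intro!: arg_cong[where f = card])
    then have "k \<le> card (D \<inter> W)" using W by (auto simp: k_def)
    then obtain T where T: "T \<subseteq> D \<inter> W" "card T = k" "finite T" using obtain_subset_with_card_n by metis
    have "card (W - T) = m - k" using T W by (subst card_Diff_subset) auto
    with T W show "W \<in> (\<Union>T\<in>?T. (\<lambda>U. T \<union> U) ` ?U T)"
      by (intro UN_I[of T] image_eqI[of _ _ "W - T"]) auto
  qed
  then have "card ?X \<le> card (\<Union>T\<in>?T. (\<lambda>U. T \<union> U) ` ?U T)"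
    using fin finD by (intro card_mono) auto
  also have "\<dots> \<le> (\<Sum>T\<in>?T. card ((\<lambda>U. T \<union> U) ` ?U T))"
    using finD by (intro card_UN_le) auto
  also have "\<dots> \<le> (\<Sum>T\<in>?T. (card B - k) choose (m - k))"
  proof (rule sum_mono)
    fix T assume T: "T \<in> ?T"
    then have "T \<subseteq> B" by (auto simp: D_def)
    have "card ((\<lambda>U. T \<union> U) ` ?U T) \<le> card (?U T)"
      using fin by (intro card_image_le) auto
    also have "\<dots> = (card B - k) choose (m - k)"
      using T fin finite_subset[OF \<open>T \<subseteq> B\<close>] card_Diff_subset[OF _ \<open>T \<subseteq> B\<close>]
      by (subst n_subsets) auto
    finally show "card ((\<lambda>U. T \<union> U) ` ?U T) \<le> (card B - k) choose (m - k)" .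
  qed
  also have "\<dots> = (card D choose k) * ((card B - k) choose (m - k))"
    using n_subsets[OF finD, of k] by simp
  finally have X: "card ?X \<le> (card D choose k) * ((card B - k) choose (m - k))" .
  \<comment> \<open>As \<open>m\<close> is at most \<open>2 * k\<close>, the factor
    \<open>16 ^ k\<close> covers \<open>4 ^ m\<close>. One \<open>2 ^ m\<close> is lost to
    \<open>m choose k\<close>, the other is the claimed decay.\<close>
  have "card ?X * 4 ^ m \<le> card ?X * 16 ^ k"
    using power_increasing[OF k(2), of "4::nat"] by (simp add: power_mult)
  also have "\<dots> \<le> ((card D choose k) * 16 ^ k) * ((card B - k) choose (m - k))"
    using X by (simp add: algebra_simps)
  also have "\<dots> \<le> (card B choose k) * ((card B - k) choose (m - k))"
    using C binomial_scale[of 16 "card D" "card B" k] by (simp add: D_def)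
  also have "\<dots> = (card B choose m) * (m choose k)"
    using choose_mult[OF k(1) m] by simp
  also have "\<dots> \<le> (card B choose m) * 2 ^ m"
    using binomial_le_pow2 by simp
  finally have "(card ?X * 2 ^ m) * 2 ^ m \<le> (card B choose m) * 2 ^ m"
    by (simp add: mult.assoc flip: power_mult_distrib)
  then show ?thesis by simp
qed

definition components :: "nat set \<Rightarrow> nat set set \<Rightarrow> nat \<Rightarrow> nat set set" where
  "components B E v = blocks (reach (B - {v}) E) (B - {v})"

text \<open>What the algorithm can observe on the sample; \<open>balanced\<close> is what the query
  bound needs.\<close>

definition halving :: "nat set \<Rightarrow> nat set set \<Rightarrow> nat set \<Rightarrow> nat \<Rightarrow> bool" where
  "halving B E W v \<longleftrightarrow> (\<forall>C\<in>components B E v. 2 * card (C \<inter> W) \<le> card W)"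

definition balanced :: "nat set \<Rightarrow> nat set set \<Rightarrow> nat \<Rightarrow> bool" where
  "balanced B E v \<longleftrightarrow> (\<forall>C\<in>components B E v. 16 * card C \<le> 15 * card B)"

text \<open>The selected vertex depends on \<open>W\<close>, so the event covers all vertices at
  once. Naming a component by a vertex in it leaves \<open>card B\<close> squared pairs for the
  union bound.\<close>

lemma prob_unbalanced:
  assumes fin: "finite B" and m: "m \<le> card B"
  shows "measure (measure_pmf (pmf_of_set {W. W \<subseteq> B \<and> card W = m}))
    {W. \<not> (\<forall>v\<in>B. halving B E W v \<longrightarrow> balanced B E v)} \<le> (real (card B))\<^sup>2 / 2 ^ m"
proof -
  let ?A = "{W. W \<subseteq> B \<and> card W = m}"
  define X where "X = (\<lambda>(v, x). {W. W \<subseteq> B \<and> card W = m \<and>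
    15 * card B < 16 * card {y \<in> B - {v}. reach (B - {v}) E x y} \<and>
    2 * card ({y \<in> B - {v}. reach (B - {v}) E x y} \<inter> W) \<le> m})"
  have A: "finite ?A" "card ?A = card B choose m"
    using fin n_subsets[OF fin] by auto
  have pos: "card B choose m > 0" using m by simp
  then have ne: "?A \<noteq> {}" using A by (metis card.empty less_numeral_extra(3))
  have X: "card (X p) * 2 ^ m \<le> card B choose m" for p
  proof -
    obtain v x where p: "p = (v, x)" by force
    let ?C = "{y \<in> B - {v}. reach (B - {v}) E x y}"
    show ?thesis
    proof (cases "15 * card B < 16 * card ?C")
      case True
      have "card (B - ?C) = card B - card ?C" using fin by (intro card_Diff_subset) auto
      with True have "16 * card (B - ?C) \<le> card B" by simp
      from card_half_missing[OF fin _ this m] True show ?thesis by (auto simp: X_def p)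
    qed (simp add: X_def p)
  qed
  have "?A \<inter> {W. \<not> (\<forall>v\<in>B. halving B E W v \<longrightarrow> balanced B E v)} \<subseteq> (\<Union>p\<in>B \<times> B. X p)"
  proof
    fix W assume W: "W \<in> ?A \<inter> {W. \<not> (\<forall>v\<in>B. halving B E W v \<longrightarrow> balanced B E v)}"
    then obtain v where v: "v \<in> B" "halving B E W v" "\<not> balanced B E v" by blast
    then obtain C where C: "C \<in> components B E v" "15 * card B < 16 * card C"
      by (auto simp: balanced_def not_le)
    then obtain x where x: "x \<in> B" "C = {y \<in> B - {v}. reach (B - {v}) E x y}"
      by (auto simp: components_def blocks_def)
    have "2 * card (C \<inter> W) \<le> card W" using v C unfolding halving_def by blast
    with W C x have "W \<in> X (v, x)" unfolding X_def by simp
    with v x show "W \<in> (\<Union>p\<in>B \<times> B. X p)" by blast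
  qed
  then have "card (?A \<inter> {W. \<not> (\<forall>v\<in>B. halving B E W v \<longrightarrow> balanced B E v)}) \<le> card (\<Union>p\<in>B \<times> B. X p)"
    using fin by (intro card_mono) (auto simp: X_def)
  also have "\<dots> \<le> (\<Sum>p\<in>B \<times> B. card (X p))"
    using fin by (intro card_UN_le) auto
  finally have "card (?A \<inter> {W. \<not> (\<forall>v\<in>B. halving B E W v \<longrightarrow> balanced B E v)}) * 2 ^ m
     \<le> (\<Sum>p\<in>B \<times> B. card (X p) * 2 ^ m)"
    by (simp flip: sum_distrib_right)
  also have "\<dots> \<le> (\<Sum>p\<in>B \<times> B. card B choose m)"
    by (intro sum_mono X)
  also have "\<dots> = (card B)\<^sup>2 * (card B choose m)" by (simp add: card_cartesian_product power2_eq_square)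
  finally have "real (card (?A \<inter> {W. \<not> (\<forall>v\<in>B. halving B E W v \<longrightarrow> balanced B E v)})) * 2 ^ m
     \<le> (real (card B))\<^sup>2 * real (card B choose m)"
    by (metis (no_types, lifting) of_nat_le_iff of_nat_mult of_nat_power of_nat_numeral)
  with pos show ?thesis
    by (subst measure_pmf_of_set[OF ne A(1)]) (simp add: A(2) field_simps)
qed

section \<open>Correctness and query count of the algorithms\<close>

text \<open>The pivots are random but the classes are not. Each round makes at most
  \<open>card A\<close> accesses and removes one class, whence the product. Only off-diagonal
  entries are read.\<close>

lemma surely_matrix_components:
  assumes R: "equivp R" and "finite A"
    and "\<And>i j. i \<in> A \<Longrightarrow> j \<in> A \<Longrightarrow> i \<noteq> j \<Longrightarrow> surely (acc j i) (\<lambda>x q. (x \<noteq> 0 \<longleftrightarrow> R i j) \<and> q \<le> b)"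
  shows "surely (matrix_components acc A) (\<lambda>Cs q. distinct Cs \<and> set Cs = blocks R A \<and>
    q \<le> b * card A * card (blocks R A))"
  using assms(2,3)
proof (induction A rule: finite_psubset_induct)
  case (psubset A)
  show ?case
  proof (cases "A = {}")
    case True
    then show ?thesis by (subst matrix_components.simps) (simp add: blocks_def)
  next
    case False
    have "surely (sample (pmf_of_set A) \<bind>\<^sub>q (\<lambda>i.
        for_each (\<lambda>j. acc j i \<bind>\<^sub>q (\<lambda>x. ret (j, x))) (sorted_list_of_set (A - {i})) \<bind>\<^sub>q (\<lambda>col.
        let C = insert i {j. \<exists>x. (j, x) \<in> set col \<and> x \<noteq> 0} in
        matrix_components acc (A - C) \<bind>\<^sub>q (\<lambda>Cs. ret (C # Cs)))))
      (\<lambda>Cs q. distinct Cs \<and> set Cs = blocks R A \<and> q \<le> b * card A * card (blocks R A))"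
    proof (rule surely_qbind[where P = "\<lambda>i q. i \<in> A \<and> q = 0"])
      show "surely (sample (pmf_of_set A)) (\<lambda>i q. i \<in> A \<and> q = 0)"
        using False psubset.hyps by simp
    next
      fix i q :: nat assume i: "i \<in> A \<and> q = 0"
      define C where "C = {y \<in> A. R i y}"
      have iC: "i \<in> C" using i R by (auto simp: C_def dest: equivp_reflp)
      then have AC: "A - C \<subset> A" by (auto simp: C_def)
      show "surely (for_each (\<lambda>j. acc j i \<bind>\<^sub>q (\<lambda>x. ret (j, x))) (sorted_list_of_set (A - {i})) \<bind>\<^sub>q (\<lambda>col.
        let C = insert i {j. \<exists>x. (j, x) \<in> set col \<and> x \<noteq> 0} in
        matrix_components acc (A - C) \<bind>\<^sub>q (\<lambda>Cs. ret (C # Cs))))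
        (\<lambda>Cs r. distinct Cs \<and> set Cs = blocks R A \<and> q + r \<le> b * card A * card (blocks R A))"
      proof (rule surely_qbind[OF surely_for_each[where
            P = "\<lambda>j y. fst y = j \<and> (snd y \<noteq> 0 \<longleftrightarrow> R i j)" and b = b]])
        fix j assume "j \<in> set (sorted_list_of_set (A - {i}))"
        then have "j \<in> A" "i \<noteq> j" using psubset.hyps by auto
        then show "surely (acc j i \<bind>\<^sub>q (\<lambda>x. ret (j, x)))
            (\<lambda>y q. (fst y = j \<and> (snd y \<noteq> 0 \<longleftrightarrow> R i j)) \<and> q \<le> b)"
          using i by (intro surely_qbind[OF psubset.prems[of i j]]) auto
      next
        fix col r
        assume col: "list_all2 (\<lambda>j y. fst y = j \<and> (snd y \<noteq> 0 \<longleftrightarrow> R i j)) (sorted_list_of_set (A - {i})) col \<and>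
          r \<le> b * length (sorted_list_of_set (A - {i}))"
        \<comment> \<open>Entries are recorded with their index, so the nonzero ones give the class
          of the pivot without the pivot.\<close>
        have *: "(\<exists>x. (j, x) \<in> set col \<and> x \<noteq> 0) \<longleftrightarrow> j \<in> A - {i} \<and> R i j" for j
        proof
          assume "\<exists>x. (j, x) \<in> set col \<and> x \<noteq> 0"
          then obtain a where "a < length col" "fst (col ! a) = j" "snd (col ! a) \<noteq> 0"
            by (metis fst_conv in_set_conv_nth snd_conv)
          with col show "j \<in> A - {i} \<and> R i j"
            using psubset.hyps nth_mem[of a "sorted_list_of_set (A - {i})"]
            by (auto simp: list_all2_conv_all_nth)
        next
          assume j: "j \<in> A - {i} \<and> R i j"
          then have "j \<in> set (sorted_list_of_set (A - {i}))" using psubset.hyps by simp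
          then obtain a where "a < length (sorted_list_of_set (A - {i}))" "sorted_list_of_set (A - {i}) ! a = j"
            by (auto simp: in_set_conv_nth)
          with col j have "col ! a \<in> set col" "fst (col ! a) = j" "snd (col ! a) \<noteq> 0"
            by (auto simp: list_all2_conv_all_nth)
          then show "\<exists>x. (j, x) \<in> set col \<and> x \<noteq> 0" by (metis prod.collapse)
        qed
        then have C: "insert i {j. \<exists>x. (j, x) \<in> set col \<and> x \<noteq> 0} = C"
          using i iC by (auto simp: C_def)
        have card: "card (blocks R A) = Suc (card (blocks R (A - C)))"
          using blocks_remove[OF R _ C_def] i psubset.hyps by simp
        have r: "r \<le> b * card A"
          using col psubset.hyps by (auto intro: order_trans mult_le_mono card_Diff1_le)
        show "surely (let C = insert i {j. \<exists>x. (j, x) \<in> set col \<and> x \<noteq> 0} in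
            matrix_components acc (A - C) \<bind>\<^sub>q (\<lambda>Cs. ret (C # Cs)))
          (\<lambda>Cs r'. distinct Cs \<and> set Cs = blocks R A \<and> q + (r + r') \<le> b * card A * card (blocks R A))"
          unfolding C Let_def
        proof (rule surely_qbind[OF psubset.IH[OF AC]])
          show "i \<in> A - C \<Longrightarrow> j \<in> A - C \<Longrightarrow> i \<noteq> j \<Longrightarrow> surely (acc j i) (\<lambda>x q. (x \<noteq> 0 \<longleftrightarrow> R i j) \<and> q \<le> b)"
            for i j using psubset.prems by simp
        next
          fix Cs s assume Cs: "distinct Cs \<and> set Cs = blocks R (A - C) \<and> s \<le> b * card (A - C) * card (blocks R (A - C))"
          have "b * card (A - C) * card (blocks R (A - C)) \<le> b * card A * card (blocks R (A - C))"
            using psubset.hyps by (intro mult_le_mono card_mono) auto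
          moreover have "b * card A * card (blocks R A) = b * card A + b * card A * card (blocks R (A - C))"
            by (simp add: card)
          ultimately have "r + s \<le> b * card A * card (blocks R A)"
            using Cs r by linarith
          then show "surely (ret (C # Cs)) (\<lambda>Cs r'. distinct Cs \<and> set Cs = blocks R A \<and>
              q + (r + (s + r')) \<le> b * card A * card (blocks R A))"
            using Cs blocks_remove[OF R _ C_def] i by simp
        qed
      qed
    qed
    then show ?thesis using False by (subst matrix_components.simps) simp
  qed
qed

lemma surely_schur_access:
  assumes "\<And>i j. surely (acc i j) (\<lambda>x q. x = S i j \<and> q = 1)"
  shows "surely (schur_access acc v i j) (\<lambda>x q. x = S i j - 1 / S v v * (S i v * S v j) \<and> q = 4)"
  unfolding schur_access_def
  by (rule surely_qbind[OF assms] surely_qbind)+ simp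

section \<open>The invariant of the recursion\<close>

text \<open>\<open>S\<close> and \<open>E\<close> stay fixed while \<open>B\<close> shrinks. At
  least two vertices make \<open>card B - 1\<close> a positive potential; the inverse of the
  marginal vanishing off \<open>E\<close> serves the base case.\<close>

definition faithful_on :: "nat set \<Rightarrow> (nat \<Rightarrow> nat \<Rightarrow> real) \<Rightarrow> nat set set \<Rightarrow> bool" where
  "faithful_on B S E \<longleftrightarrow> finite B \<and> 2 \<le> card B \<and> (\<forall>i. {i} \<notin> E) \<and>
     (\<forall>u\<in>B. \<forall>v\<in>B. reach B E u v) \<and> spd_on B S \<and> (\<forall>i\<in>B. \<forall>j\<in>B. S i j \<noteq> 0) \<and>
     (\<forall>v\<in>B. \<forall>i\<in>B - {v}. \<forall>j\<in>B - {v}. i \<noteq> j \<longrightarrow>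
        (S i j * S v v = S i v * S v j \<longleftrightarrow> \<not> reach (B - {v}) E i j)) \<and>
     (\<exists>K. inverse_on B S K \<and> (\<forall>i\<in>B. \<forall>j\<in>B. i \<noteq> j \<and> {i, j} \<notin> E \<longrightarrow> K i j = 0))"

lemma faithful_onD:
  assumes "faithful_on B S E"
  shows "finite B" "2 \<le> card B" "{i} \<notin> E" "u \<in> B \<Longrightarrow> v \<in> B \<Longrightarrow> reach B E u v" "spd_on B S"
    "i \<in> B \<Longrightarrow> j \<in> B \<Longrightarrow> S i j \<noteq> 0"
    "v \<in> B \<Longrightarrow> i \<in> B - {v} \<Longrightarrow> j \<in> B - {v} \<Longrightarrow> i \<noteq> j \<Longrightarrow>
      S i j * S v v = S i v * S v j \<longleftrightarrow> \<not> reach (B - {v}) E i j"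
  using assms unfolding faithful_on_def by blast+

lemma faithful_on_inverse:
  "faithful_on B S E \<Longrightarrow>
    \<exists>K. inverse_on B S K \<and> (\<forall>i\<in>B. \<forall>j\<in>B. i \<noteq> j \<and> {i, j} \<notin> E \<longrightarrow> K i j = 0)"
  by (simp add: faithful_on_def)

text \<open>Connectivity transfers by the collapse to \<open>v\<close>. The inverse transfers
  because \<open>v\<close> separates \<open>C\<close> from the rest, so its off-diagonal entries
  survive. Two vertices remain since components are nonempty.\<close>

lemma faithful_on_split:
  assumes f: "faithful_on B S E" and v: "v \<in> B" and C: "C \<in> components B E v"
  shows "faithful_on (insert v C) S E"
proof -
  note D = faithful_onD[OF f]
  have C': "C \<in> blocks (reach (B - {v}) E) (B - {v})" using C by (simp add: components_def)
  have sub: "C \<subseteq> B - {v}" by (rule blocks_subset[OF C'])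
  have finC: "finite C" using sub D(1) finite_subset by auto
  have ne: "C \<noteq> {}" by (rule block_nonempty[OF equivp_reach C'])
  obtain K where K: "inverse_on B S K" and "\<forall>i\<in>B. \<forall>j\<in>B. i \<noteq> j \<and> {i, j} \<notin> E \<longrightarrow> K i j = 0"
    using faithful_on_inverse[OF f] by blast
  then have K0: "K i j = 0" if "i \<in> B" "j \<in> B" "i \<noteq> j" "{i, j} \<notin> E" for i j
    using that by simp
  have out: "\<not> reach (B - {v}) E c d" if "c \<in> C" "d \<in> B - {v} - C" for c d
    using that block_eq[OF equivp_reach C' that(1)] by auto
  have "\<exists>K'. inverse_on (insert v C) S K' \<and> (\<forall>i j. i \<noteq> j \<longrightarrow> K' i j = K i j)"
  proof (rule inverse_on_restrict[OF D(1) K v sub])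
    fix c d assume cd: "c \<in> C" "d \<in> B - {v} - C"
    have "{c, d} \<notin> E"
    proof
      assume "{c, d} \<in> E"
      then have "adj (B - {v}) E c d" using cd sub by (auto simp: adj_def)
      with out[OF cd] show False by blast
    qed
    then show "K c d = 0" using cd sub by (intro K0) auto
    show "S c d * S v v = S c v * S v d"
      using cd sub out[OF cd] D(7)[of v c d] v by blast
  qed (use spd_on_sym[OF D(5)] D(6)[of v v] v in auto)
  then obtain K' where K': "inverse_on (insert v C) S K'" "\<And>i j. i \<noteq> j \<Longrightarrow> K' i j = K i j"
    by blast
  have 1: "\<forall>w\<in>insert v C. \<forall>i\<in>insert v C - {w}. \<forall>j\<in>insert v C - {w}. i \<noteq> j \<longrightarrow>
      (S i j * S w w = S i w * S w j \<longleftrightarrow> \<not> reach (insert v C - {w}) E i j)"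
  proof (intro ballI impI)
    fix w i j
    assume *: "w \<in> insert v C" "i \<in> insert v C - {w}" "j \<in> insert v C - {w}" "i \<noteq> j"
    then have "w \<in> B" "i \<in> B - {w}" "j \<in> B - {w}" using sub v by auto
    from D(7)[OF this *(4)] reach_split[OF C' v *(1-3)]
    show "S i j * S w w = S i w * S w j \<longleftrightarrow> \<not> reach (insert v C - {w}) E i j" by simp
  qed
  have 2: "\<forall>i\<in>insert v C. \<forall>j\<in>insert v C. reach (insert v C) E i j"
  proof (intro ballI)
    fix i j assume *: "i \<in> insert v C" "j \<in> insert v C"
    then have "i \<in> B" "j \<in> B" using sub v by auto
    from reach_split_all[OF C' v * D(4)[OF this]] show "reach (insert v C) E i j" .
  qed
  have 3: "2 \<le> card (insert v C)"
  proof -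
    have "v \<notin> C" "card C > 0" using finC ne sub by (auto simp: card_gt_0_iff)
    then show ?thesis using finC by simp
  qed
  have 4: "spd_on (insert v C) S"
    using sub v by (intro spd_on_subset[OF D(5) _ D(1)]) auto
  have 5: "\<forall>i\<in>insert v C. \<forall>j\<in>insert v C. i \<noteq> j \<and> {i, j} \<notin> E \<longrightarrow> K' i j = 0"
  proof (intro ballI impI)
    fix i j assume ij: "i \<in> insert v C" "j \<in> insert v C" "i \<noteq> j \<and> {i, j} \<notin> E"
    then have "i \<in> B" "j \<in> B" using sub v by auto
    with ij show "K' i j = 0" using K'(2) K0 by simp
  qed
  have 6: "\<forall>i\<in>insert v C. \<forall>j\<in>insert v C. S i j \<noteq> 0"
  proof (intro ballI)
    fix i j assume "i \<in> insert v C" "j \<in> insert v C"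
    then have "i \<in> B" "j \<in> B" using sub v by auto
    then show "S i j \<noteq> 0" by (rule D(6))
  qed
  have 7: "finite (insert v C)" "\<forall>i. {i} \<notin> E" using finC D(3) by simp_all
  show ?thesis
    unfolding faithful_on_def
    by (intro conjI exI[of _ K']) (fact 1 2 3 4 5 6 7 K'(1))+
qed

text \<open>The invariant keeps all blocks connected, so only acyclicity has to be split.\<close>

lemma is_tree_split:
  assumes f: "faithful_on B S E" and v: "v \<in> B"
  shows "is_tree B E \<longleftrightarrow> (\<forall>C\<in>components B E v. is_tree (insert v C) E)"
proof -
  have "is_tree (insert v C) E \<longleftrightarrow> acyc (insert v C) E" if "C \<in> components B E v" for C
    using faithful_onD(4)[OF faithful_on_split[OF f v that]] by (auto simp: is_tree_iff)
  moreover have "is_tree B E \<longleftrightarrow> acyc B E"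
    using faithful_onD(4)[OF f] v by (auto simp: is_tree_iff)
  ultimately show ?thesis using acyc_split[OF v, of E] by (auto simp: components_def)
qed

lemma is_tree_base:
  assumes f: "faithful_on B S E"
  defines "xs \<equiv> sorted_list_of_set B"
  shows "is_tree {..<card B} (support_edges (the (mat_inverse
      (mat_of_rows_list (card B) (map (\<lambda>i. map (\<lambda>j. S i j) xs) xs))))) \<longleftrightarrow> is_tree B E"
proof -
  note D = faithful_onD[OF f]
  obtain K where K: "inverse_on B S K" and "\<forall>i\<in>B. \<forall>j\<in>B. i \<noteq> j \<and> {i, j} \<notin> E \<longrightarrow> K i j = 0"
    using faithful_on_inverse[OF f] by blast
  then have K0: "K i j = 0" if "i \<in> B" "j \<in> B" "i \<noteq> j" "{i, j} \<notin> E" for i j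
    using that by simp
  show ?thesis
    unfolding xs_def is_tree_support_edges[OF D(1) K]
    using D(7) by (intro is_tree_kernel_edges[OF D(1,5) K D(3) K0 D(6)]) blast+
qed

text \<open>Classes of the sample are the nonempty traces of classes of \<open>A\<close>, and empty
  traces satisfy the bound.\<close>

lemma blocks_halved_iff:
  assumes R: "equivp R" and "W \<subseteq> A"
  shows "(\<forall>D\<in>blocks R W. 2 * card D \<le> m) \<longleftrightarrow> (\<forall>C\<in>blocks R A. 2 * card (C \<inter> W) \<le> (m :: nat))"
proof (intro iffI ballI)
  fix C assume l: "\<forall>D\<in>blocks R W. 2 * card D \<le> m" and C: "C \<in> blocks R A"
  show "2 * card (C \<inter> W) \<le> m"
  proof (cases "C \<inter> W = {}")
    case False
    then obtain x where x: "x \<in> C" "x \<in> W" by blast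
    then have "C \<inter> W = {y \<in> W. R x y}"
      using block_eq[OF R C x(1)] assms(2) by auto
    with x have "C \<inter> W \<in> blocks R W" by (auto simp: blocks_def)
    with l show ?thesis by blast
  qed simp
next
  fix D assume l: "\<forall>C\<in>blocks R A. 2 * card (C \<inter> W) \<le> m" and D: "D \<in> blocks R W"
  then obtain x where x: "x \<in> W" "D = {y \<in> W. R x y}" by (auto simp: blocks_def)
  with assms(2) have "{y \<in> A. R x y} \<in> blocks R A" "D = {y \<in> A. R x y} \<inter> W"
    by (auto simp: blocks_def)
  with l show "2 * card D \<le> m" by auto
qed

section \<open>The search for a balanced vertex\<close>

text \<open>Everything after drawing \<open>W\<close>: its guarantees hold surely for each fixed
  sample, so probability enters only through \<open>W\<close>.\<close>

definition partition_by_sample ::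
    "(nat set \<Rightarrow> nat pmf) \<Rightarrow> access \<Rightarrow> nat set \<Rightarrow> nat set \<Rightarrow> (nat \<times> nat set list) option comp" where
  "partition_by_sample tie acc V W =
     for_each (\<lambda>v. matrix_components (schur_access acc v) (W - {v}) \<bind>\<^sub>q (\<lambda>Cs.
         ret (v, real (card V) * real (Max (insert 0 (card ` set Cs))) / real (card W))))
       (sorted_list_of_set V) \<bind>\<^sub>q (\<lambda>Ms.
     let M = (\<lambda>v. the (map_of Ms v)) in
     if Min (M ` V) > real (card V) / 2 then ret None
     else sample (tie {v. is_arg_min M (\<lambda>v. v \<in> V) v}) \<bind>\<^sub>q (\<lambda>v.
       matrix_components (schur_access acc v) (V - {v}) \<bind>\<^sub>q (\<lambda>Cs. ret (Some (v, Cs)))))"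

lemma find_balanced_partition_tree_eq:
  "find_balanced_partition_tree tie acc V m =
     sample (pmf_of_set {W. W \<subseteq> V \<and> card W = m}) \<bind>\<^sub>q partition_by_sample tie acc V"
  by (simp add: find_balanced_partition_tree_def partition_by_sample_def[abs_def])

text \<open>The part of the specification that never fails. Balance is left out, since an unlucky
  sample can violate it; two components suffice for the recursion to shrink.\<close>

definition good_partition :: "nat set \<Rightarrow> nat set set \<Rightarrow> (nat \<times> nat set list) option \<Rightarrow> bool" where
  "good_partition B E r \<longleftrightarrow> (case r of None \<Rightarrow> \<not> is_tree B E
     | Some (v, Cs) \<Rightarrow> v \<in> B \<and> distinct Cs \<and> set Cs = components B E v \<and> 2 \<le> card (components B E v))"

lemma surely_schur_components:
  assumes f: "faithful_on B S E" and acc: "\<And>i j. surely (acc i j) (\<lambda>x q. x = S i j \<and> q = 1)"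
    and v: "v \<in> B" and A: "A \<subseteq> B - {v}"
  shows "surely (matrix_components (schur_access acc v) A)
    (\<lambda>Cs q. distinct Cs \<and> set Cs = blocks (reach (B - {v}) E) A \<and>
      q \<le> 4 * card A * card (blocks (reach (B - {v}) E) A))"
proof (rule surely_matrix_components[OF equivp_reach])
  note D = faithful_onD[OF f]
  show "finite A" using A D(1) finite_subset by auto
  fix i j assume ij: "i \<in> A" "j \<in> A" "i \<noteq> j"
  show "surely (schur_access acc v j i) (\<lambda>x q. (x \<noteq> 0 \<longleftrightarrow> reach (B - {v}) E i j) \<and> q \<le> 4)"
  proof (rule surely_mono[OF surely_schur_access[OF acc]])
    fix x :: real and q :: nat assume x: "x = S j i - 1 / S v v * (S j v * S v i) \<and> q = 4"
    have "x * S v v = S j i * S v v - S j v * S v i"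
      using x D(6)[OF v v] by (simp add: field_simps)
    moreover have "x = 0 \<longleftrightarrow> x * S v v = 0" using D(6)[OF v v] by simp
    ultimately have "x = 0 \<longleftrightarrow> S j i * S v v = S j v * S v i" by simp
    also have "\<dots> \<longleftrightarrow> \<not> reach (B - {v}) E j i"
      using D(7)[OF v, of j i] ij A by blast
    finally show "(x \<noteq> 0 \<longleftrightarrow> reach (B - {v}) E i j) \<and> q \<le> 4"
      using x reach_sym by blast
  qed
qed

text \<open>A single component would contain all of \<open>W - {v}\<close>, hence at least
  \<open>card W - 1\<close> sampled vertices, more than half once \<open>card W\<close> is at least
  3.\<close>

lemma two_components:
  assumes f: "faithful_on B S E" and v: "v \<in> B" and W: "W \<subseteq> B" "3 \<le> card W" and h: "halving B E W v"
  shows "2 \<le> card (components B E v)"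
proof (rule ccontr)
  note D = faithful_onD[OF f]
  assume n: "\<not> 2 \<le> card (components B E v)"
  have fin: "finite (components B E v)" "finite W"
    using D(1) W finite_subset by (auto simp: components_def)
  have "W - {v} = (\<Union>C\<in>components B E v. C \<inter> W)"
    using Union_blocks[OF equivp_reach, of "B - {v}" E "B - {v}"] W by (auto simp: components_def)
  then have "card (W - {v}) \<le> (\<Sum>C\<in>components B E v. card (C \<inter> W))"
    using card_UN_le[OF fin(1)] by metis
  then have "2 * card (W - {v}) \<le> (\<Sum>C\<in>components B E v. 2 * card (C \<inter> W))"
    by (simp flip: sum_distrib_left)
  also have "\<dots> \<le> card (components B E v) * card W"
    using h sum_bounded_above[of "components B E v" "\<lambda>C. 2 * card (C \<inter> W)" "card W"]
    by (auto simp: halving_def)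
  also have "\<dots> \<le> 1 * card W" using n by (intro mult_le_mono) auto
  finally show False using W fin(2) by (simp add: card_Diff_singleton_if split: if_splits)
qed

text \<open>Rejection is sound by \<open>centroid\<close>, as a score of at most half means halving
  \<open>W\<close>. Each score costs \<open>4 * m * min m \<Delta>\<close>, since the sample has at
  most \<open>m\<close> vertices and meets at most \<open>\<Delta>\<close> components; the final run
  costs at most \<open>4 * card B * \<Delta>\<close>.\<close>

lemma surely_partition_by_sample:
  assumes f: "faithful_on B S E" and acc: "\<And>i j. surely (acc i j) (\<lambda>x q. x = S i j \<and> q = 1)"
    and tie: "tie_breaking tie" and W: "W \<subseteq> B" "card W = m" "3 \<le> m"
    and deg: "\<And>v. v \<in> B \<Longrightarrow> card {u \<in> B. {u, v} \<in> E} \<le> \<Delta>"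
  shows "surely (partition_by_sample tie acc B W) (\<lambda>r q. good_partition B E r \<and>
    (\<forall>v Cs. r = Some (v, Cs) \<longrightarrow> halving B E W v) \<and> q \<le> 4 * card B * (m * min m \<Delta> + \<Delta>))"
proof -
  note D = faithful_onD[OF f]
  define R where "R v = reach (B - {v}) E" for v
  have R: "equivp (R v)" for v by (simp add: R_def equivp_reach)
  define score where "score v = real (card B) * real (Max (insert 0 (card ` blocks (R v) (W - {v})))) / real (card W)" for v
  have finW: "finite W" using W(1) D(1) finite_subset by auto
  have ncomp: "card (blocks (R v) (B - {v})) \<le> \<Delta>" if "v \<in> B" for v
    using card_components_le_degree[OF D(1) that D(4)] deg[OF that] that by (fastforce simp: R_def)
  have score: "score v \<le> real (card B) / 2 \<longleftrightarrow> halving B E W v" if v: "v \<in> B" for v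
  proof -
    have B: "card B > 0" using D(2) by simp
    have "score v \<le> real (card B) / 2 \<longleftrightarrow> 2 * Max (insert 0 (card ` blocks (R v) (W - {v}))) \<le> m"
    proof -
      define M where "M = Max (insert 0 (card ` blocks (R v) (W - {v})))"
      have "score v \<le> real (card B) / 2 \<longleftrightarrow> real (2 * M) \<le> real m"
        using B W(2,3) by (simp add: score_def field_simps flip: M_def)
      then show ?thesis by (simp only: of_nat_le_iff M_def)
    qed
    also have "\<dots> \<longleftrightarrow> (\<forall>D\<in>blocks (R v) (W - {v}). 2 * card D \<le> m)"
    proof -
      \<comment> \<open>Halving with rounding moves the factor 2 off the maximum, whose bound is
        then read elementwise; the default 0 satisfies it.\<close>
      have "2 * (k::nat) \<le> m \<longleftrightarrow> k \<le> m div 2" for k by auto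
      then show ?thesis using finW by (simp del: Max_insert)
    qed
    also have "\<dots> \<longleftrightarrow> (\<forall>C\<in>blocks (R v) (B - {v}). 2 * card (C \<inter> (W - {v})) \<le> m)"
      using W by (intro blocks_halved_iff[OF R]) auto
    also have "\<dots> \<longleftrightarrow> halving B E W v"
    proof -
      have "C \<inter> (W - {v}) = C \<inter> W" if "C \<in> blocks (R v) (B - {v})" for C
        using blocks_subset[OF that] by auto
      then show ?thesis by (simp add: halving_def components_def R_def W)
    qed
    finally show ?thesis .
  qed
  have each: "surely (matrix_components (schur_access acc v) (W - {v}) \<bind>\<^sub>q (\<lambda>Cs.
         ret (v, real (card B) * real (Max (insert 0 (card ` set Cs))) / real (card W))))
      (\<lambda>y q. y = (v, score v) \<and> q \<le> 4 * m * min m \<Delta>)" if v: "v \<in> B" for v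
  proof -
    have "W - {v} \<subseteq> B - {v}" using W by auto
    note comp = surely_schur_components[OF f acc v this, folded R_def]
    have le: "4 * card (W - {v}) * card (blocks (R v) (W - {v})) \<le> 4 * m * min m \<Delta>"
    proof (intro mult_le_mono min.boundedI)
      show "card (W - {v}) \<le> m" using W finW card_Diff1_le by metis
      with card_blocks_le[OF R, of "W - {v}" v] finW show "card (blocks (R v) (W - {v})) \<le> m" by simp
      show "card (blocks (R v) (W - {v})) \<le> \<Delta>"
        using card_blocks_mono[OF R, of "B - {v}" "W - {v}" v] ncomp[OF v] D(1) W by fastforce
    qed simp
    show ?thesis
      by (rule surely_qbind[OF comp]) (use le in \<open>auto simp: score_def\<close>)
  qed
  show ?thesis
    unfolding partition_by_sample_def
  proof (rule surely_qbind[OF surely_for_each[where P = "\<lambda>v y. y = (v, score v)" and b = "4 * m * min m \<Delta>"]])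
    show "v \<in> set (sorted_list_of_set B) \<Longrightarrow> surely (matrix_components (schur_access acc v) (W - {v}) \<bind>\<^sub>q (\<lambda>Cs.
         ret (v, real (card B) * real (Max (insert 0 (card ` set Cs))) / real (card W))))
      (\<lambda>y q. y = (v, score v) \<and> q \<le> 4 * m * min m \<Delta>)" for v
      using each D(1) by simp
  next
    fix Ms q
    assume Ms: "list_all2 (\<lambda>v y. y = (v, score v)) (sorted_list_of_set B) Ms \<and>
      q \<le> 4 * m * min m \<Delta> * length (sorted_list_of_set B)"
    then have "Ms = map (\<lambda>v. (v, score v)) (sorted_list_of_set B)"
      by (auto simp: list_all2_conv_all_nth intro!: nth_equalityI)
    then have M: "the (map_of Ms v) = score v" if "v \<in> B" for v
      using that D(1) by (simp add: map_of_map_restrict)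
    have q: "q \<le> 4 * card B * (m * min m \<Delta>)" using Ms D(1) by (simp add: algebra_simps)
    have ne: "B \<noteq> {}" using D(2) by auto
    have img: "(\<lambda>v. the (map_of Ms v)) ` B = score ` B" using M by auto
    have arg: "{v. is_arg_min (\<lambda>v. the (map_of Ms v)) (\<lambda>v. v \<in> B) v} = {v. is_arg_min score (\<lambda>v. v \<in> B) v}"
      using M by (auto simp: is_arg_min_def)
    let ?X = "{v. is_arg_min score (\<lambda>v. v \<in> B) v}"
    have X: "finite ?X" "?X \<noteq> {}"
      using ex_is_arg_min_if_finite[OF D(1) ne, of score] D(1) by (auto simp: is_arg_min_def)
    show "surely (let M = \<lambda>v. the (map_of Ms v) in
       if Min (M ` B) > real (card B) / 2 then ret None
       else sample (tie {v. is_arg_min M (\<lambda>v. v \<in> B) v}) \<bind>\<^sub>q (\<lambda>v.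
         matrix_components (schur_access acc v) (B - {v}) \<bind>\<^sub>q (\<lambda>Cs. ret (Some (v, Cs)))))
      (\<lambda>r q'. good_partition B E r \<and> (\<forall>v Cs. r = Some (v, Cs) \<longrightarrow> halving B E W v) \<and>
        q + q' \<le> 4 * card B * (m * min m \<Delta> + \<Delta>))"
      unfolding Let_def img arg
    proof (split if_split, intro conjI impI)
      assume "Min (score ` B) > real (card B) / 2"
      then have "\<not> score v \<le> real (card B) / 2" if "v \<in> B" for v
        using that D(1) by (metis Min_le finite_imageI imageI not_le order_less_le_trans)
      then have "\<not> halving B E W v" if "v \<in> B" for v using that score by blast
      then have "\<not> is_tree B E"
        using centroid[OF _ D(1) W(1) refl, of E] unfolding halving_def components_def by blast
      then show "surely (ret None) (\<lambda>r q'. good_partition B E r \<and>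
          (\<forall>v Cs. r = Some (v, Cs) \<longrightarrow> halving B E W v) \<and> q + q' \<le> 4 * card B * (m * min m \<Delta> + \<Delta>))"
        using q by (simp add: good_partition_def add_mult_distrib2)
    next
      assume le: "\<not> real (card B) / 2 < Min (score ` B)"
      show "surely (sample (tie ?X) \<bind>\<^sub>q (\<lambda>v.
          matrix_components (schur_access acc v) (B - {v}) \<bind>\<^sub>q (\<lambda>Cs. ret (Some (v, Cs)))))
        (\<lambda>r q'. good_partition B E r \<and> (\<forall>v Cs. r = Some (v, Cs) \<longrightarrow> halving B E W v) \<and>
          q + q' \<le> 4 * card B * (m * min m \<Delta> + \<Delta>))"
      proof (rule surely_qbind[where P = "\<lambda>v q. v \<in> ?X \<and> q = 0"])
        show "surely (sample (tie ?X)) (\<lambda>v q. v \<in> ?X \<and> q = 0)"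
          using tie X unfolding tie_breaking_def by fastforce
      next
        fix v s assume v: "v \<in> ?X \<and> s = (0 :: nat)"
        then have vB: "v \<in> B" by (simp add: is_arg_min_def)
        have "Min (score ` B) \<in> score ` B" using D(1) ne by (intro Min_in) auto
        then obtain u where "u \<in> B" "score u \<le> real (card B) / 2"
          using le unfolding not_less by (metis imageE)
        moreover from this v have "score v \<le> score u" by (auto simp: is_arg_min_linorder)
        ultimately have h: "halving B E W v" using score[OF vB] by linarith
        have two: "2 \<le> card (components B E v)" using two_components[OF f vB W(1) _ h] W by simp
        show "surely (matrix_components (schur_access acc v) (B - {v}) \<bind>\<^sub>q (\<lambda>Cs. ret (Some (v, Cs))))
          (\<lambda>r q'. good_partition B E r \<and> (\<forall>v Cs. r = Some (v, Cs) \<longrightarrow> halving B E W v) \<and>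
            q + (s + q') \<le> 4 * card B * (m * min m \<Delta> + \<Delta>))"
        proof (rule surely_qbind[OF surely_schur_components[OF f acc vB order_refl]])
          fix Cs t
          assume Cs: "distinct Cs \<and> set Cs = blocks (reach (B - {v}) E) (B - {v}) \<and>
            t \<le> 4 * card (B - {v}) * card (blocks (reach (B - {v}) E) (B - {v}))"
          have "4 * card (B - {v}) * card (blocks (reach (B - {v}) E) (B - {v})) \<le> 4 * card B * \<Delta>"
            using ncomp[OF vB] D(1) by (intro mult_le_mono card_mono) (auto simp: R_def)
          with Cs q have "q + t \<le> 4 * card B * (m * min m \<Delta> + \<Delta>)"
            unfolding add_mult_distrib2 by linarith
          then show "surely (ret (Some (v, Cs))) (\<lambda>r q'. good_partition B E r \<and>
              (\<forall>v Cs. r = Some (v, Cs) \<longrightarrow> halving B E W v) \<and>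
              q + (s + (t + q')) \<le> 4 * card B * (m * min m \<Delta> + \<Delta>))"
            using Cs v vB h two by (simp add: good_partition_def components_def)
        qed
      qed
    qed
  qed
qed

text \<open>A returned vertex always halves \<open>W\<close>. Outside the bad samples halving
  implies balance for all vertices, so the sample alone accounts for the failure
  probability.\<close>

lemma find_balanced_partition_tree_spec:
  assumes f: "faithful_on B S E" and acc: "\<And>i j. surely (acc i j) (\<lambda>x q. x = S i j \<and> q = 1)"
    and tie: "tie_breaking tie" and m: "3 \<le> m" "m \<le> card B"
    and deg: "\<And>v. v \<in> B \<Longrightarrow> card {u \<in> B. {u, v} \<in> E} \<le> \<Delta>"
  shows "surely (find_balanced_partition_tree tie acc B m)
      (\<lambda>r q. good_partition B E r \<and> q \<le> 4 * card B * (m * min m \<Delta> + \<Delta>))"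
    and "failure (find_balanced_partition_tree tie acc B m)
      (\<lambda>r q. \<forall>v Cs. r = Some (v, Cs) \<longrightarrow> balanced B E v) \<le> (real (card B))\<^sup>2 / 2 ^ m"
proof -
  note D = faithful_onD[OF f]
  let ?A = "{W. W \<subseteq> B \<and> card W = m}"
  have A: "finite ?A" "?A \<noteq> {}"
    using D(1) obtain_subset_with_card_n[OF m(2)] by auto
  have smp: "surely (sample (pmf_of_set ?A)) (\<lambda>W q. W \<in> ?A \<and> q = 0)"
    using A by simp
  note part = surely_partition_by_sample[OF f acc tie _ _ m(1) deg]
  show "surely (find_balanced_partition_tree tie acc B m)
      (\<lambda>r q. good_partition B E r \<and> q \<le> 4 * card B * (m * min m \<Delta> + \<Delta>))"
    unfolding find_balanced_partition_tree_eq
    by (rule surely_qbind[OF smp], rule surely_mono[OF part]) auto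
  have "failure (sample (pmf_of_set ?A) \<bind>\<^sub>q partition_by_sample tie acc B)
      (\<lambda>r q. \<forall>v Cs. r = Some (v, Cs) \<longrightarrow> balanced B E v) \<le> (real (card B))\<^sup>2 / 2 ^ m + 0"
  proof (rule failure_qbind[OF smp])
    show "failure (sample (pmf_of_set ?A)) (\<lambda>W q. \<forall>v\<in>B. halving B E W v \<longrightarrow> balanced B E v)
        \<le> (real (card B))\<^sup>2 / 2 ^ m"
      unfolding failure_sample by (rule prob_unbalanced[OF D(1) m(2)])
  next
    fix W q assume W: "W \<in> ?A \<and> q = (0 :: nat)" and bal: "\<forall>v\<in>B. halving B E W v \<longrightarrow> balanced B E v"
    have "surely (partition_by_sample tie acc B W) (\<lambda>r q. \<forall>v Cs. r = Some (v, Cs) \<longrightarrow> balanced B E v)"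
      by (rule surely_mono[OF part]) (use W bal in \<open>auto simp: good_partition_def\<close>)
    then show "failure (partition_by_sample tie acc B W) (\<lambda>r q. \<forall>v Cs. r = Some (v, Cs) \<longrightarrow> balanced B E v) \<le> 0"
      by (simp add: failure_eq_0)
  qed simp
  then show "failure (find_balanced_partition_tree tie acc B m)
      (\<lambda>r q. \<forall>v Cs. r = Some (v, Cs) \<longrightarrow> balanced B E v) \<le> (real (card B))\<^sup>2 / 2 ^ m"
    by (simp add: find_balanced_partition_tree_eq)
qed

section \<open>The recursion and its query budget\<close>

lemma list_all2_eq_map: "list_all2 (\<lambda>x y. y = f x) xs ys \<Longrightarrow> ys = map f xs"
  by (auto simp: list_all2_conv_all_nth intro!: nth_equalityI)

lemma surely_query_all:
  assumes "\<And>i j. surely (acc i j) (\<lambda>x q. x = S i j \<and> q = 1)"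
  shows "surely (for_each (\<lambda>i. for_each (\<lambda>j. acc i j) ys) xs)
    (\<lambda>rows q. rows = map (\<lambda>i. map (\<lambda>j. S i j) ys) xs \<and> q \<le> length ys * length xs)"
proof -
  have inner: "surely (for_each (\<lambda>j. acc i j) ys) (\<lambda>r q. r = map (\<lambda>j. S i j) ys \<and> q \<le> length ys)" for i
  proof (rule surely_mono[OF surely_for_each[where P = "\<lambda>j x. x = S i j" and b = 1]])
    show "surely (acc i j) (\<lambda>x q. x = S i j \<and> q \<le> 1)" for j
      by (rule surely_mono[OF assms]) simp
  qed (auto dest: list_all2_eq_map)
  show ?thesis
    by (rule surely_mono[OF surely_for_each[OF inner]]) (auto dest: list_all2_eq_map)
qed

text \<open>The base \<open>32/31\<close> comes from \<open>15/16 (s + 1) \<le> 31/32 s\<close> for \<open>s \<ge> 30\<close>.\<close>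

definition cost_bound :: "real \<Rightarrow> nat \<Rightarrow> real" where
  "cost_bound Q s = 8 * Q * real s * (1 + ln (real s) / ln (32 / 31))"

lemma cost_bound_nonneg: "0 \<le> Q \<Longrightarrow> 0 \<le> cost_bound Q s"
  by (cases "s = 0") (auto simp: cost_bound_def)

text \<open>Each child is smaller by the factor 31/32 and loses one unit of the logarithm. As the
  sizes add up to \<open>s\<close>, this frees \<open>8 * Q * s\<close>, the budget of the call
  itself.\<close>

lemma cost_bound_sum:
  assumes Q: "0 \<le> Q" and c: "\<And>C. C \<in> F \<Longrightarrow> 1 \<le> c C" "\<And>C. C \<in> F \<Longrightarrow> 16 * c C \<le> 15 * (s + 1)"
    and s: "(\<Sum>C\<in>F. c C) = s" "30 \<le> s"
  shows "(\<Sum>C\<in>F. cost_bound Q (c C)) + 8 * Q * real s \<le> cost_bound Q s"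
proof -
  have "cost_bound Q (c C) \<le> 8 * Q * real (c C) * (ln (real s) / ln (32 / 31))" if C: "C \<in> F" for C
  proof -
    have "real (c C) * (32 / 31) \<le> real s" using c(2)[OF C] s(2) by simp
    then have "ln (real (c C) * (32 / 31)) \<le> ln (real s)"
      using c(1)[OF C] by (intro ln_mono) auto
    then have "ln (real (c C)) + ln (32 / 31) \<le> ln (real s)"
      using c(1)[OF C] by (subst (asm) ln_mult) auto
    then have "(ln (real (c C)) + ln (32 / 31)) / ln (32 / 31) \<le> ln (real s) / ln (32 / 31)"
      by (intro divide_right_mono) auto
    then have "1 + ln (real (c C)) / ln (32 / 31) \<le> ln (real s) / ln (32 / 31)"
      by (simp add: add_divide_distrib)
    then show ?thesis
      unfolding cost_bound_def using Q by (intro mult_left_mono) auto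
  qed
  then have "(\<Sum>C\<in>F. cost_bound Q (c C)) \<le> (\<Sum>C\<in>F. 8 * Q * real (c C) * (ln (real s) / ln (32 / 31)))"
    by (rule sum_mono)
  also have "\<dots> = 8 * Q * real s * (ln (real s) / ln (32 / 31))"
    by (simp flip: s(1) sum_distrib_left sum_distrib_right sum_divide_distrib)
  finally show ?thesis by (simp add: cost_bound_def distrib_left)
qed

text \<open>The budget uses \<open>card B - 1\<close>, additive although the children share
  \<open>v\<close>; the failure bound uses \<open>card B - 2\<close>, since two or more children
  leave one unit for the call itself. \<open>n\<close> bounds all block sizes, which makes the error
  per call uniform.\<close>

lemma test_tree_spec:
  assumes acc: "\<And>i j. surely (acc i j) (\<lambda>x q. x = S i j \<and> q = 1)"
    and tie: "tie_breaking tie" and m: "30 \<le> m" and \<Delta>: "1 \<le> \<Delta>"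
    and f: "faithful_on B S E" and n: "card B \<le> n"
    and deg: "\<And>v. v \<in> B \<Longrightarrow> card {u \<in> B. {u, v} \<in> E} \<le> \<Delta>"
  defines "Q \<equiv> real (m * min m \<Delta> + \<Delta>)"
  shows "surely (test_tree tie acc B m) (\<lambda>b q. b = is_tree B E) \<and>
    failure (test_tree tie acc B m) (\<lambda>b q. real q \<le> cost_bound Q (card B - 1))
      \<le> (real n)\<^sup>2 / 2 ^ m * real (card B - 2)"
  using f n deg
proof (induction "card B" arbitrary: B rule: less_induct)
  case less
  note f = less.prems(1)
  note D = faithful_onD[OF f]
  let ?s = "card B - 1" and ?\<delta> = "(real n)\<^sup>2 / 2 ^ m"
  \<comment> \<open>\<open>min m \<Delta>\<close> is positive, so one unit \<open>Q\<close> pays for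
    a row of the matrix in the base case.\<close>
  have "m * 1 \<le> m * min m \<Delta>" using m \<Delta> by (intro mult_le_mono) auto
  then have "m \<le> m * min m \<Delta> + \<Delta>" by linarith
  then have Q: "Q \<ge> real m" "Q \<ge> 0" unfolding Q_def by (simp_all only: of_nat_le_iff of_nat_0_le_iff)
  have s: "1 \<le> ?s" "card B \<le> 2 * ?s" using D(2) by auto
  show ?case
  proof (cases "card B \<le> m")
    case True
    have sure: "surely (test_tree tie acc B m) (\<lambda>b q. b = is_tree B E \<and> real q \<le> cost_bound Q ?s)"
    proof (subst test_tree.simps, simp only: True if_True, rule surely_qbind[OF surely_query_all[where S = S, OF acc]])
      fix rows q
      assume r: "rows = map (\<lambda>i. map (\<lambda>j. S i j) (sorted_list_of_set B)) (sorted_list_of_set B) \<and>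
        q \<le> length (sorted_list_of_set B) * length (sorted_list_of_set B)"
      have "real q \<le> real (card B) * real (card B)"
        using r D(1) by (simp flip: of_nat_mult)
      also have "\<dots> \<le> Q * (2 * real ?s)"
        using s Q True by (intro mult_mono) auto
      also have "\<dots> \<le> 8 * Q * real ?s * 1" using Q by simp
      also have "\<dots> \<le> cost_bound Q ?s"
        unfolding cost_bound_def using Q s by (intro mult_left_mono) auto
      finally show "surely (ret (is_tree {..<card B}
           (support_edges (the (mat_inverse (mat_of_rows_list (card B) rows))))))
         (\<lambda>b r. b = is_tree B E \<and> real (q + r) \<le> cost_bound Q ?s)"
        using is_tree_base[OF f] r by simp
    qed
    have "failure (test_tree tie acc B m) (\<lambda>b q. real q \<le> cost_bound Q ?s) = 0"
      by (rule failure_eq_0[OF surely_mono[OF sure]]) simp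
    then show ?thesis
      using sure by (auto elim: surely_mono)
  next
    case False
    then have m': "3 \<le> m" "m \<le> card B" using m by auto
    note find = find_balanced_partition_tree_spec[OF f acc tie m' less.prems(3)]
    let ?next = "\<lambda>r. case r of None \<Rightarrow> ret False
      | Some vCs \<Rightarrow> all_tests (\<lambda>C. test_tree tie acc (insert (fst vCs) C) m) (snd vCs)"
    have eq: "test_tree tie acc B m = find_balanced_partition_tree tie acc B m \<bind>\<^sub>q ?next"
      using False by (subst test_tree.simps) simp
    have children: "card C \<ge> 1 \<and> (\<Sum>C\<in>set Cs. card C) = ?s \<and>
      surely (test_tree tie acc (insert v C) m) (\<lambda>b q. b = is_tree (insert v C) E) \<and>
      failure (test_tree tie acc (insert v C) m) (\<lambda>b q. real q \<le> cost_bound Q (card C)) \<le> ?\<delta> * real (card C - 1)"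
      if g: "good_partition B E (Some (v, Cs))" and C: "C \<in> set Cs" for v Cs C
    proof -
      from g have v: "v \<in> B" and Cs: "set Cs = components B E v" "2 \<le> card (set Cs)"
        by (auto simp: good_partition_def)
      have comp: "C \<subseteq> B - {v}" "C \<noteq> {}" if "C \<in> set Cs" for C
        using that blocks_subset block_nonempty[OF equivp_reach] by (auto simp: Cs components_def)
      have sum: "(\<Sum>C\<in>set Cs. card C) = ?s"
        using sum_card_blocks[OF equivp_reach, of "B - {v}" "B - {v}" E] D(1) v
        by (simp add: Cs components_def)
      have fin: "finite C" if "C \<in> set Cs" for C
        using comp[OF that] D(1) by (meson finite_Diff finite_subset)
      have pos: "card C \<ge> 1" if "C \<in> set Cs" for C
        using comp[OF that] fin[OF that] by (simp add: Suc_le_eq card_gt_0_iff)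
      \<comment> \<open>A sibling contributes a vertex, so the block of \<open>C\<close> is strictly
        smaller than \<open>B\<close> even though it regains \<open>v\<close>.\<close>
      have "set Cs - {C} \<noteq> {}"
      proof
        assume "set Cs - {C} = {}"
        then have "set Cs \<subseteq> {C}" by auto
        from card_mono[OF _ this] Cs(2) show False by simp
      qed
      then obtain C' where C': "C' \<in> set Cs - {C}" by blast
      have "(\<Sum>C\<in>set Cs. card C) = card C + (\<Sum>C\<in>set Cs - {C}. card C)"
        using C by (intro sum.remove) auto
      moreover have "card C' \<le> (\<Sum>C\<in>set Cs - {C}. card C)"
        using C' by (intro member_le_sum) auto
      ultimately have lt: "card C < ?s" using sum pos[of C'] C' by simp
      have card: "card (insert v C) = Suc (card C)" using comp[OF C] fin[OF C] by (subst card_insert_disjoint) auto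
      have sub: "insert v C \<subseteq> B" using comp[OF C] v by auto
      have "surely (test_tree tie acc (insert v C) m) (\<lambda>b q. b = is_tree (insert v C) E) \<and>
        failure (test_tree tie acc (insert v C) m) (\<lambda>b q. real q \<le> cost_bound Q (card (insert v C) - 1))
          \<le> ?\<delta> * real (card (insert v C) - 2)"
      proof (rule less.hyps)
        show "card (insert v C) < card B" using card lt by simp
        then show "card (insert v C) \<le> n" using less.prems(2) by simp
        show "faithful_on (insert v C) S E" using faithful_on_split[OF f v] C Cs by simp
        fix u assume u: "u \<in> insert v C"
        have "card {w \<in> insert v C. {w, u} \<in> E} \<le> card {w \<in> B. {w, u} \<in> E}"
          using sub D(1) by (intro card_mono) auto
        also have "\<dots> \<le> \<Delta>" using u sub by (intro less.prems(3)) auto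
        finally show "card {w \<in> insert v C. {w, u} \<in> E} \<le> \<Delta>" .
      qed
      then show ?thesis using pos[OF C] sum by (simp add: card numeral_2_eq_2)
    qed
    have sure: "surely (?next r) (\<lambda>b q. b = is_tree B E)" if g: "good_partition B E r" for r
    proof (cases r)
      case None
      with g show ?thesis by (simp add: good_partition_def)
    next
      case (Some vCs)
      obtain v Cs where r: "r = Some (v, Cs)" using Some by (cases vCs) simp
      have "surely (all_tests (\<lambda>C. test_tree tie acc (insert v C) m) Cs)
          (\<lambda>b q. b = (\<forall>C\<in>set Cs. is_tree (insert v C) E))"
        using children g[unfolded r] by (intro surely_all_tests) blast
      moreover have "(\<forall>C\<in>set Cs. is_tree (insert v C) E) = is_tree B E"
        using g[unfolded r] is_tree_split[OF f, of v] by (simp add: good_partition_def)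
      ultimately show ?thesis by (simp add: r)
    qed
    have "surely (test_tree tie acc B m) (\<lambda>b q. b = is_tree B E)"
      unfolding eq
    proof (rule surely_qbind[OF find(1)])
      fix r q assume "good_partition B E r \<and> q \<le> 4 * card B * (m * min m \<Delta> + \<Delta>)"
      then show "surely (?next r) (\<lambda>b t. b = is_tree B E)" using sure[of r] by blast
    qed
    moreover have "failure (find_balanced_partition_tree tie acc B m \<bind>\<^sub>q ?next)
        (\<lambda>b q. real q \<le> cost_bound Q ?s) \<le> (real (card B))\<^sup>2 / 2 ^ m + ?\<delta> * real (card B - 3)"
    proof (rule failure_qbind[OF find])
      fix r q
      assume r: "good_partition B E r \<and> q \<le> 4 * card B * (m * min m \<Delta> + \<Delta>)"
        and bal: "\<forall>v Cs. r = Some (v, Cs) \<longrightarrow> balanced B E v"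
      have "real q \<le> real (4 * card B * (m * min m \<Delta> + \<Delta>))" using r by (simp only: of_nat_le_iff)
      also have "\<dots> = 4 * real (card B) * Q" by (simp only: Q_def of_nat_mult of_nat_numeral)
      \<comment> \<open>Passing from \<open>card B\<close> to twice \<open>card B - 1\<close> turns
        the factor 4 of the search into the 8 of \<open>cost_bound\<close>.\<close>
      also have "\<dots> \<le> 4 * real (2 * ?s) * Q"
      proof (intro mult_right_mono mult_left_mono Q)
        show "real (card B) \<le> real (2 * ?s)" using s by (simp only: of_nat_le_iff)
      qed simp
      finally have q: "real q \<le> 8 * Q * real ?s" by (simp add: mult_ac)
      show "failure (?next r) (\<lambda>b t. real (q + t) \<le> cost_bound Q ?s) \<le> ?\<delta> * real (card B - 3)"
      proof (cases r)
        case None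
        \<comment> \<open>A rejecting call has no children; the summand 1 in
          \<open>cost_bound\<close> pays for its search.\<close>
        have "8 * Q * real ?s * 1 \<le> cost_bound Q ?s"
          unfolding cost_bound_def using Q s by (intro mult_left_mono) auto
        with q show ?thesis by (simp add: None failure_eq_0)
      next
        case (Some vCs)
        obtain v Cs where rS: "r = Some (v, Cs)" using Some by (cases vCs) simp
        have g: "good_partition B E (Some (v, Cs))" using r rS by simp
        note ch = children[OF g]
        have dist: "distinct Cs" and Cs: "set Cs = components B E v" "2 \<le> card (set Cs)"
          using g by (auto simp: good_partition_def)
        then obtain C0 where C0: "C0 \<in> set Cs" by (metis card.empty ex_in_conv not_numeral_le_zero)
        have sum: "(\<Sum>C\<in>set Cs. card C) = ?s" using ch[OF C0] by blast
        have all: "failure (all_tests (\<lambda>C. test_tree tie acc (insert v C) m) Cs)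
            (\<lambda>b t. real t \<le> sum_list (map (\<lambda>C. cost_bound Q (card C)) Cs))
            \<le> sum_list (map (\<lambda>C. ?\<delta> * real (card C - 1)) Cs)"
        proof (rule failure_all_tests[where P = "\<lambda>C. is_tree (insert v C) E"])
          fix C assume C: "C \<in> set Cs"
          show "surely (test_tree tie acc (insert v C) m) (\<lambda>b q. b = is_tree (insert v C) E)"
            and "failure (test_tree tie acc (insert v C) m) (\<lambda>b q. real q \<le> cost_bound Q (card C))
              \<le> ?\<delta> * real (card C - 1)"
            using ch[OF C] by blast+
          show "0 \<le> cost_bound Q (card C)" using Q(2) by (rule cost_bound_nonneg)
        qed simp
        have le: "(\<Sum>C\<in>set Cs. cost_bound Q (card C)) + 8 * Q * real ?s \<le> cost_bound Q ?s"
        proof (rule cost_bound_sum[OF Q(2) _ _ sum])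
          show "1 \<le> card C" if "C \<in> set Cs" for C using ch[OF that] by blast
          show "16 * card C \<le> 15 * (?s + 1)" if "C \<in> set Cs" for C
            using bal rS that Cs s by (auto simp: balanced_def)
          show "30 \<le> ?s" using False m by simp
        qed
        \<comment> \<open>Each child gives up one unit, so two children bring
          \<open>card B - 1\<close> down to \<open>card B - 3\<close>.\<close>
        have "(\<Sum>C\<in>set Cs. card C - 1) + card (set Cs) = ?s"
        proof -
          have "(\<Sum>C\<in>set Cs. card C - 1) + card (set Cs) = (\<Sum>C\<in>set Cs. card C - 1 + 1)"
            by (simp add: sum.distrib del: One_nat_def)
          also have "\<dots> = (\<Sum>C\<in>set Cs. card C)" using ch by (intro sum.cong) force+
          finally show ?thesis using sum by simp
        qed
        then have "(\<Sum>C\<in>set Cs. card C - 1) \<le> card B - 3" using Cs by linarith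
        then have "?\<delta> * real (\<Sum>C\<in>set Cs. card C - 1) \<le> ?\<delta> * real (card B - 3)"
          by (intro mult_left_mono) (simp_all only: of_nat_le_iff divide_nonneg_nonneg zero_le_power2 zero_le_power zero_le_numeral)
        then have d: "sum_list (map (\<lambda>C. ?\<delta> * real (card C - 1)) Cs) \<le> ?\<delta> * real (card B - 3)"
          by (simp add: sum_list_distinct_conv_sum_set[OF dist] sum_distrib_left)
        have "failure (all_tests (\<lambda>C. test_tree tie acc (insert v C) m) Cs)
            (\<lambda>b t. real (q + t) \<le> cost_bound Q ?s)
          \<le> failure (all_tests (\<lambda>C. test_tree tie acc (insert v C) m) Cs)
            (\<lambda>b t. real t \<le> sum_list (map (\<lambda>C. cost_bound Q (card C)) Cs))"
          using sure[OF g] le q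
          by (intro failure_mono[where S = "\<lambda>b q. b = is_tree B E"])
            (auto simp: sum_list_distinct_conv_sum_set[OF dist])
        with all d show ?thesis by (simp add: rS)
      qed
    qed auto
    moreover have "(real (card B))\<^sup>2 / 2 ^ m + ?\<delta> * real (card B - 3) \<le> ?\<delta> * real (card B - 2)"
    proof -
      have "(real (card B))\<^sup>2 / 2 ^ m \<le> ?\<delta>"
        using less.prems(2) by (intro divide_right_mono power_mono) auto
      moreover have "real (card B - 2) = 1 + real (card B - 3)" using m m' by auto
      then have "?\<delta> * real (card B - 2) = ?\<delta> + ?\<delta> * real (card B - 3)"
        by (simp only: distrib_left mult_1_right)
      ultimately show ?thesis by linarith
    qed
    ultimately show ?thesis unfolding eq by linarith
  qed
qed

section \<open>Sample size and asymptotics\<close>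

text \<open>With \<open>Y\<close> the argument of the logarithm, \<open>ln Y\<close> lies between
  \<open>L\<close> and \<open>6 * L\<close>, so \<open>m\<close> and \<open>L\<close> are
  comparable. Moreover \<open>m * ln 2\<close> is at least \<open>2 * ln Y\<close>, so
  \<open>2 ^ m\<close> is at least the square of \<open>Y\<close>, and \<open>Y\<close> dominates
  both the square of \<open>n\<close> and \<open>n / \<epsilon>\<close>.\<close>

lemma sample_size_bounds:
  assumes n: "2 \<le> n" and e: "0 < \<epsilon>" "\<epsilon> < 1"
  defines "m \<equiv> sample_size n \<epsilon>" and "L \<equiv> ln (real n / \<epsilon>)"
  shows "0 < L" "L \<le> real m" "real m \<le> 110 * L" "30 \<le> m" "real n ^ 3 / 2 ^ m \<le> \<epsilon>"
proof -
  define x where "x = real n"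
  define Y where "Y = 5 * x\<^sup>2 / \<epsilon> * ln x"
  have x: "2 \<le> x" using n by (simp add: x_def)
  have xe: "x \<le> x / \<epsilon>" using e x by (simp add: field_simps)
  have xe2: "2 \<le> x / \<epsilon>" using xe x by linarith
  have ln2: "1 / 2 \<le> ln (2::real)" using ln2_ge_two_thirds by simp
  have lnx: "1 / 2 \<le> ln x"
  proof -
    have "ln 2 \<le> ln x" using x by (intro ln_mono) auto
    with ln2 show ?thesis by linarith
  qed
  have "ln 2 \<le> ln (x / \<epsilon>)" using xe2 by (intro ln_mono) auto
  then have L: "1 / 2 \<le> L" using ln2 by (simp add: L_def x_def)
  then show "0 < L" by simp
  have Y1: "2 * x\<^sup>2 / \<epsilon> \<le> Y"
  proof -
    have "5 * x\<^sup>2 / \<epsilon> * (1 / 2) \<le> Y" unfolding Y_def using lnx e by (intro mult_left_mono) auto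
    moreover have "2 * x\<^sup>2 / \<epsilon> \<le> 5 * x\<^sup>2 / \<epsilon> * (1 / 2)" using e by (simp add: field_simps)
    ultimately show ?thesis by linarith
  qed
  have xsq: "4 \<le> x\<^sup>2" using power_mono[OF x, of 2] by simp
  have "2 * x\<^sup>2 \<le> 2 * x\<^sup>2 / \<epsilon>"
    using e mult_right_mono[of \<epsilon> 1 "x\<^sup>2"] by (simp add: field_simps)
  then have Y8: "8 \<le> Y" using Y1 xsq by linarith
  have YL: "x / \<epsilon> \<le> Y"
  proof -
    have "x \<le> 2 * x\<^sup>2" using x mult_right_mono[of 1 "2 * x" x] by (simp add: power2_eq_square)
    then have "x / \<epsilon> \<le> 2 * x\<^sup>2 / \<epsilon>" using e by (intro divide_right_mono) auto
    with Y1 show ?thesis by linarith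
  qed
  have Y6: "Y \<le> (x / \<epsilon>) ^ 6"
  proof -
    have "Y \<le> 5 * x\<^sup>2 / \<epsilon> * x"
      unfolding Y_def using e x by (intro mult_left_mono less_imp_le[OF ln_less_self]) auto
    also have "\<dots> = 5 * x ^ 3 / \<epsilon>" by (simp add: power2_eq_square power3_eq_cube)
    \<comment> \<open>5 is below \<open>x ^ 3\<close>, as \<open>x\<close> is at least 2.\<close>
    also have "\<dots> \<le> x ^ 3 * x ^ 3 / \<epsilon>"
      using power_mono[OF x, of 3] x e by (intro divide_right_mono mult_right_mono) auto
    also have "\<dots> = x ^ 6 / \<epsilon>" by (simp flip: power_add)
    also have "\<dots> \<le> x ^ 6 / \<epsilon> ^ 6"
      using e x power_decreasing[of 1 6 \<epsilon>] by (intro divide_left_mono) auto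
    finally show ?thesis by (simp add: power_divide)
  qed
  have lnY: "L \<le> ln Y" using YL xe2 by (auto simp: L_def x_def intro!: ln_mono)
  have "ln Y \<le> ln ((x / \<epsilon>) ^ 6)" using Y6 Y8 by (intro ln_mono) auto
  also have "\<dots> = 6 * L" using xe2 by (subst ln_realpow) (auto simp: L_def x_def)
  finally have lnY6: "ln Y \<le> 6 * L" .
  have m: "18 * ln Y \<le> real m" "real m \<le> 18 * ln Y + 1"
    using lnY L unfolding m_def sample_size_def by (fold x_def, fold Y_def) linarith+
  show "L \<le> real m" using m lnY L by linarith
  \<comment> \<open>18 times 6 is 108, and rounding adds at most 1, which is at most
    \<open>2 * L\<close>.\<close>
  show "real m \<le> 110 * L" using m lnY6 L by linarith
  have "ln (2 ^ 3) \<le> ln Y" using Y8 by (intro ln_mono) auto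
  moreover have "ln ((2::real) ^ 3) = 3 * ln 2" by (subst ln_realpow) auto
  ultimately have "2 \<le> ln Y" using ln2_ge_two_thirds by linarith
  then have "30 \<le> real m" using m by linarith
  then show "30 \<le> m" by simp
  have "Y\<^sup>2 = exp (2 * ln Y)" using Y8 by (simp add: exp_double)
  also have "\<dots> \<le> exp (real m * ln 2)"
  proof -
    have "2 * ln Y \<le> real m * (1 / 2)" using m \<open>2 \<le> ln Y\<close> by linarith
    also have "\<dots> \<le> real m * ln 2" using ln2 by (intro mult_left_mono) auto
    finally show ?thesis by simp
  qed
  also have "\<dots> = 2 ^ m" by (simp add: exp_of_nat_mult)
  finally have Ym: "Y\<^sup>2 \<le> 2 ^ m" .
  have "x ^ 3 / \<epsilon> \<le> Y\<^sup>2"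
  proof -
    have "x ^ 3 / \<epsilon> \<le> x\<^sup>2 * (x / \<epsilon>)" by (simp add: power2_eq_square power3_eq_cube)
    also have "\<dots> \<le> Y * Y"
    proof (intro mult_mono YL)
      show "x\<^sup>2 \<le> Y" using \<open>2 * x\<^sup>2 \<le> 2 * x\<^sup>2 / \<epsilon>\<close> Y1 xsq by linarith
    qed (use Y8 x e in auto)
    finally show ?thesis by (simp add: power2_eq_square)
  qed
  with Ym have "x ^ 3 / \<epsilon> \<le> 2 ^ m" by linarith
  then show "real n ^ 3 / 2 ^ m \<le> \<epsilon>" using e by (simp add: x_def field_simps)
qed

lemma bigO_admissibleI:
  assumes "\<And>n \<Delta> \<epsilon>. 2 \<le> n \<Longrightarrow> 1 \<le> \<Delta> \<Longrightarrow> 0 < \<epsilon> \<Longrightarrow> \<epsilon> < 1 \<Longrightarrow> \<bar>f (n, \<Delta>, \<epsilon>)\<bar> \<le> c * \<bar>g (n, \<Delta>, \<epsilon>)\<bar>"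
  shows "f \<in> bigO g"
  using assms by (intro bigoI[of _ c]) (auto simp: eventually_principal admissible_def)

lemma bound_m_eq:
  "bound_m (n, \<Delta>, \<epsilon>) = real n * ln (real n) * real (sample_size n \<epsilon> * min (sample_size n \<epsilon>) \<Delta> + \<Delta>)"
  by (simp add: bound_m_def Let_def of_nat_min)

lemma cost_bound_in_bigO:
  "(\<lambda>(n, \<Delta>, \<epsilon>). cost_bound (real (sample_size n \<epsilon> * min (sample_size n \<epsilon>) \<Delta> + \<Delta>)) n) \<in> bigO bound_m"
proof (rule bigO_admissibleI[where c = "8 * (2 + 1 / ln (32 / 31))"])
  fix n \<Delta> :: nat and \<epsilon> :: real assume n: "2 \<le> n"
  define Q where "Q = real (sample_size n \<epsilon> * min (sample_size n \<epsilon>) \<Delta> + \<Delta>)"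
  have Q: "Q \<ge> 0" by (simp add: Q_def)
  have "ln 2 \<le> ln (real n)" using n by (intro ln_mono) auto
  \<comment> \<open>For \<open>n\<close> at least 2 the logarithm absorbs the summand 1.\<close>
  then have ln: "1 \<le> 2 * ln (real n)" using ln2_ge_two_thirds by linarith
  have "\<bar>cost_bound Q n\<bar> = 8 * Q * real n * (1 + ln (real n) / ln (32 / 31))"
    using cost_bound_nonneg[OF Q, of n] by (simp add: cost_bound_def)
  also have "\<dots> \<le> 8 * Q * real n * (2 * ln (real n) + ln (real n) / ln (32 / 31))"
    using Q ln by (intro mult_left_mono add_right_mono) auto
  also have "\<dots> = 8 * (2 + 1 / ln (32 / 31)) * (real n * ln (real n) * Q)"
    by (simp add: algebra_simps)
  also have "real n * ln (real n) * Q = \<bar>bound_m (n, \<Delta>, \<epsilon>)\<bar>"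
    using n Q unfolding bound_m_eq Q_def[symmetric] by simp
  finally show "\<bar>case (n, \<Delta>, \<epsilon>) of (n, \<Delta>, \<epsilon>) \<Rightarrow>
      cost_bound (real (sample_size n \<epsilon> * min (sample_size n \<epsilon>) \<Delta> + \<Delta>)) n\<bar>
      \<le> 8 * (2 + 1 / ln (32 / 31)) * \<bar>bound_m (n, \<Delta>, \<epsilon>)\<bar>"
    by (simp only: prod.case Q_def)
qed

lemma bigO_bound_m_eq_bound_log: "bigO bound_m = bigO bound_log"
proof (rule landau_o.big.cong_bigtheta, rule bigthetaI)
  have "\<bar>bound_m (n, \<Delta>, \<epsilon>)\<bar> \<le> 12100 * \<bar>bound_log (n, \<Delta>, \<epsilon>)\<bar> \<and> \<bar>bound_log (n, \<Delta>, \<epsilon>)\<bar> \<le> 1 * \<bar>bound_m (n, \<Delta>, \<epsilon>)\<bar>"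
    if n: "2 \<le> n" and \<Delta>: "1 \<le> \<Delta>" and e: "0 < \<epsilon>" "\<epsilon> < 1" for n \<Delta> :: nat and \<epsilon> :: real
  proof -
    define m L d where "m = real (sample_size n \<epsilon>)" and "L = ln (real n / \<epsilon>)" and "d = real \<Delta>"
    have b: "0 < L" "L \<le> m" "m \<le> 110 * L" and d: "1 \<le> d"
      using sample_size_bounds[OF n e] \<Delta> by (auto simp: m_def L_def d_def)
    have nl: "0 \<le> real n * ln (real n)" using n by simp
    \<comment> \<open>Each of the two factors is enlarged by at most 110, whence 12100.\<close>
    have "m * min m d \<le> (110 * L) * (110 * min L d)"
      using b d by (intro mult_mono) (auto simp: min_def)
    then have 1: "m * min m d + d \<le> 12100 * (L * min L d + d)" using d by simp
    have "L * min L d \<le> m * min m d"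
      using b d by (intro mult_mono) auto
    then have 2: "L * min L d + d \<le> m * min m d + d" by simp
    have eq: "bound_m (n, \<Delta>, \<epsilon>) = real n * ln (real n) * (m * min m d + d)"
      "bound_log (n, \<Delta>, \<epsilon>) = real n * ln (real n) * (L * min L d + d)"
      by (simp_all add: bound_m_def bound_log_def m_def L_def d_def Let_def)
    have pos: "0 \<le> L * min L d + d" "0 \<le> m * min m d + d" using b d by auto
    have "0 \<le> bound_log (n, \<Delta>, \<epsilon>)" "0 \<le> bound_m (n, \<Delta>, \<epsilon>)"
      using mult_nonneg_nonneg[OF nl pos(1)] mult_nonneg_nonneg[OF nl pos(2)] unfolding eq .
    moreover have "bound_m (n, \<Delta>, \<epsilon>) \<le> 12100 * bound_log (n, \<Delta>, \<epsilon>)"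
      using mult_left_mono[OF 1 nl] unfolding eq by (simp only: mult_ac)
    moreover have "bound_log (n, \<Delta>, \<epsilon>) \<le> bound_m (n, \<Delta>, \<epsilon>)"
      using mult_left_mono[OF 2 nl] unfolding eq .
    ultimately show ?thesis by simp
  qed
  note le = this
  show "bound_m \<in> bigO bound_log"
    by (rule bigO_admissibleI[where c = 12100]) (use le in blast)
  show "bound_m \<in> \<Omega>[principal admissible](bound_log)"
    unfolding bigomega_iff_bigo by (rule bigO_admissibleI[where c = 1]) (use le in blast)
qed

section \<open>The initial block and the total failure probability\<close>

lemma faithful_on_model:
  assumes "2 \<le> n" "simple_graph {..<n} E" "graph_connected {..<n} E" "\<Sigma> \<in> faithful_model 1 n E"
  shows "faithful_on {..<n} (\<lambda>i j. \<Sigma> $$ (i, j)) E"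
proof -
  note F = faithful_model_entries[OF assms(4,3)]
  have loop: "\<forall>i. {i} \<notin> E"
  proof (intro allI notI)
    fix i assume "{i} \<in> E"
    with assms(2) obtain u v where "{i} = {u, v}" "u \<noteq> v" unfolding simple_graph_def by blast
    then show False by (metis doubleton_eq_iff insert_absorb2)
  qed
  show ?thesis
    unfolding faithful_on_def
  proof (intro conjI loop F(1))
    show "\<forall>u\<in>{..<n}. \<forall>v\<in>{..<n}. reach {..<n} E u v" using assms(3) by (simp add: graph_connected_iff)
    show "\<forall>i\<in>{..<n}. \<forall>j\<in>{..<n}. \<Sigma> $$ (i, j) \<noteq> 0" using F(3) by simp
    show "\<forall>v\<in>{..<n}. \<forall>i\<in>{..<n} - {v}. \<forall>j\<in>{..<n} - {v}. i \<noteq> j \<longrightarrow>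
        (\<Sigma> $$ (i, j) * \<Sigma> $$ (v, v) = \<Sigma> $$ (i, v) * \<Sigma> $$ (v, j)) = (\<not> reach ({..<n} - {v}) E i j)"
      using F(4) by simp
    show "\<exists>K. inverse_on {..<n} (\<lambda>i j. \<Sigma> $$ (i, j)) K \<and>
        (\<forall>i\<in>{..<n}. \<forall>j\<in>{..<n}. i \<noteq> j \<and> {i, j} \<notin> E \<longrightarrow> K i j = 0)"
      using F(2) by (simp only: Ball_def lessThan_iff)
  qed (use assms(1) in auto)
qed

lemma max_degree_ge:
  assumes "v < n"
  shows "card {u \<in> {..<n}. {u, v} \<in> E} \<le> max_degree {..<n} E"
proof -
  have "vertex_degree {..<n} E v \<le> max_degree {..<n} E"
    unfolding max_degree_def using assms by (intro Max_ge) auto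
  then show ?thesis by (simp add: vertex_degree_def)
qed

text \<open>A walk from 1 to 0 provides an edge at 0. Positivity of the degree makes
  \<open>min m \<Delta>\<close> positive in the query bound.\<close>

lemma max_degree_pos:
  assumes "2 \<le> n" "graph_connected {..<n} E"
  shows "1 \<le> max_degree {..<n} E"
proof -
  have "reach {..<n} E 1 0" using assms by (auto simp: graph_connected_iff)
  from reach_neighbour[OF this] obtain u where "u \<in> {u \<in> {..<n}. {u, 0} \<in> E}" by auto
  then have "card {u \<in> {..<n}. {u, 0} \<in> E} > 0" by (auto simp: card_gt_0_iff)
  with max_degree_ge[of 0 n E] assms(1) show ?thesis by linarith
qed

text \<open>Losslessness matters: missing mass would lie in neither of the two complementary
  events.\<close>

lemma measure_ge_failure:
  assumes "lossless_spmf c"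
  shows "measure (measure_spmf c) {(x, q). P x q} = 1 - failure c P"
proof -
  have "measure (measure_spmf c) (space (measure_spmf c) - {z. \<not> P (fst z) (snd z)})
      = measure (measure_spmf c) (space (measure_spmf c)) - failure c P"
    unfolding failure_def by (rule measure_spmf.finite_measure_compl) simp
  moreover have "space (measure_spmf c) - {z. \<not> P (fst z) (snd z)} = {(x, q). P x q}"
    by (auto simp: space_measure_spmf)
  moreover have "measure (measure_spmf c) (space (measure_spmf c)) = 1"
    using assms by (simp add: lossless_spmf_def weight_spmf_def space_measure_spmf)
  ultimately show ?thesis by simp
qed

theorem theorem3p5:
  shows "\<exists>T \<in> bigO bound_m. bigO bound_m = bigO bound_log \<and>
    (\<forall>(n::nat) (E::nat set set) (\<Sigma>::real mat) (\<epsilon>::real) (tie::nat set \<Rightarrow> nat pmf).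
       2 \<le> n \<and> simple_graph {..<n} E \<and> graph_connected {..<n} E \<and>
       \<Sigma> \<in> faithful_model 1 n E \<and> 0 < \<epsilon> \<and> \<epsilon> < 1 \<and> tie_breaking tie \<longrightarrow>
       (let run = test_tree tie (query_entry \<Sigma>) {..<n} (sample_size n \<epsilon>) in
          map_spmf fst run = return_spmf (is_tree {..<n} E) \<and>
          measure (measure_spmf run)
            {(answer, queries). real queries \<le> T (n, max_degree {..<n} E, \<epsilon>)} \<ge> 1 - \<epsilon>))"
proof (intro bexI[OF _ cost_bound_in_bigO] conjI bigO_bound_m_eq_bound_log allI impI)
  fix n :: nat and E :: "nat set set" and \<Sigma> :: "real mat" and \<epsilon> :: real and tie :: "nat set \<Rightarrow> nat pmf"
  assume H: "2 \<le> n \<and> simple_graph {..<n} E \<and> graph_connected {..<n} E \<and>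
       \<Sigma> \<in> faithful_model 1 n E \<and> 0 < \<epsilon> \<and> \<epsilon> < 1 \<and> tie_breaking tie"
  then have n: "2 \<le> n" and e: "0 < \<epsilon>" "\<epsilon> < 1" and tie: "tie_breaking tie"
    and G: "graph_connected {..<n} E" and f: "faithful_on {..<n} (\<lambda>i j. \<Sigma> $$ (i, j)) E"
    using faithful_on_model[of n E \<Sigma>] by auto
  define m where "m = sample_size n \<epsilon>"
  define \<Delta> where "\<Delta> = max_degree {..<n} E"
  define Q where "Q = real (m * min m \<Delta> + \<Delta>)"
  define run where "run = test_tree tie (query_entry \<Sigma>) {..<n} m"
  have m: "30 \<le> m" "real n ^ 3 / 2 ^ m \<le> \<epsilon>" using sample_size_bounds[OF n e] by (simp_all add: m_def)
  have spec: "surely run (\<lambda>b q. b = is_tree {..<n} E)"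
    "failure run (\<lambda>b q. real q \<le> cost_bound Q (n - 1)) \<le> (real n)\<^sup>2 / 2 ^ m * real (n - 2)"
    using test_tree_spec[OF surely_query_entry tie m(1) _ f order_refl, of \<Delta>]
      max_degree_ge[of _ n E] max_degree_pos[OF n G] by (simp_all add: run_def Q_def \<Delta>_def)
  have "failure run (\<lambda>b q. real q \<le> cost_bound Q n) \<le> failure run (\<lambda>b q. real q \<le> cost_bound Q (n - 1))"
  proof (rule failure_mono[OF spec(1)])
    \<comment> \<open>The recursion yields the budget at \<open>n - 1\<close>, while the Landau
      bound is stated at \<open>n\<close>.\<close>
    have "cost_bound Q (n - 1) \<le> cost_bound Q n"
      unfolding cost_bound_def using n
      by (intro mult_mono add_left_mono divide_right_mono ln_mono mult_left_mono) (auto simp: Q_def)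
    then show "real q \<le> cost_bound Q (n - 1) \<Longrightarrow> real q \<le> cost_bound Q n" for q by linarith
  qed
  also have "\<dots> \<le> (real n)\<^sup>2 / 2 ^ m * real (n - 2)" by (rule spec(2))
  also have "\<dots> \<le> (real n)\<^sup>2 / 2 ^ m * real n" by (intro mult_left_mono) auto
  also have "\<dots> = real n ^ 3 / 2 ^ m" by (simp add: power2_eq_square power3_eq_cube)
  also have "\<dots> \<le> \<epsilon>" by (rule m(2))
  finally have fail: "failure run (\<lambda>b q. real q \<le> cost_bound Q n) \<le> \<epsilon>" .
  have lossless: "lossless_spmf run" using spec(1) by (simp add: surely_def)
  \<comment> \<open>A lossless distribution with a single possible answer is a point mass.\<close>
  have "map_spmf fst run = return_spmf (is_tree {..<n} E)"
    using spec(1) by (auto simp: surely_def map_spmf_conv_bind_spmf bind_eq_return_spmf)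
  moreover have "measure (measure_spmf run) {(answer, queries). real queries \<le> cost_bound Q n} \<ge> 1 - \<epsilon>"
    unfolding measure_ge_failure[OF lossless] using fail by simp
  ultimately show "let run = test_tree tie (query_entry \<Sigma>) {..<n} (sample_size n \<epsilon>) in
      map_spmf fst run = return_spmf (is_tree {..<n} E) \<and>
      1 - \<epsilon> \<le> measure (measure_spmf run) {(answer, queries). real queries \<le>
        (case (n, max_degree {..<n} E, \<epsilon>) of (n, \<Delta>, \<epsilon>) \<Rightarrow>
          cost_bound (real (sample_size n \<epsilon> * min (sample_size n \<epsilon>) \<Delta> + \<Delta>)) n)}"
    by (simp add: run_def m_def Q_def \<Delta>_def Let_def)
qed

end
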